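(* Let $(E,[\cdot,\cdot])$ be a locally convex Poisson vector space with respect to $\mathcal{S}=c$, and let $U\subseteq E$ be open. Then the Poisson bracket $\{\cdot,\cdot\}\colon C^\infty_{\mathbb{K}}(U,\mathbb{K})\times C^\infty_{\mathbb{K}}(U,\mathbb{K})\to C^\infty_{\mathbb{K}}(U,\mathbb{K})$ is hypocontinuous (in the second argument) with respect to compact subsets of $C^\infty_{\mathbb{K}}(U,\mathbb{K})$. If $[\cdot,\cdot]\colon E'_c\times E'_c\to E'_c$ is continuous, then the Poisson bracket is continuous.
   Context: $E'_c$ is the dual of $E$ with the topology of uniform convergence on compact sets; $L(V,W)_c$ similarly. A Hausdorff space is a $k^\infty$-space if all its finite powers are $k$-spaces. A locally convex Poisson vector space w.r.t. $c$ is a locally convex space $E$ which is a $k^\infty$-space, whose evaluation map $\eta_E\colon E\to(E'_c)'_c$, $\eta_E(x)(\lambda)=\lambda(x)$, is a topological embedding, with a bilinear map $[\cdot,\cdot]\colon E'_c\times E'_c\to E'_c$ making $E'$ a Lie algebra, hypocontinuous in the second argument with respect to compact subsets of $E'_c$ (separately continuous, and for each compact $M$ and $0$-neighbourhood $W$ there is a $0$-neighbourhood $V$ with $[V,M]\subseteq W$), and with $\eta_E(x)\circ[\lambda,\cdot]\in\eta_E(E)$ for all $x\in E,\lambda\in E'$. The Poisson bracket is $\{f,g\}(x)=[f'(x),g'(x)](x)$, $f'(x)=df(x,\cdot)$. $C^\infty_{\mathbb{K}}(U,F)$ carries the $C^\infty$-topology: the initial topology w.r.t. the maps $f\mapsto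 d^kf\in C(U\times E^k,F)$ (compact-open topology), $k\in\mathbb{N}_0$, where $d^0f=f$ and $d^kf(x,y_1,\dots,y_k)=(D_{y_k}\cdots D_{y_1}f)(x)$ are iterated directional derivatives. Hypocontinuity of a bilinear map with respect to compact subsets of the second factor is defined as for $[\cdot,\cdot]$. *)

theory Defs
  imports "HOL-Analysis.Analysis"
begin

text \<open>Scalars: any real normed field 'k (by Mazur's theorem these are exactly R and C up to
isomorphism).  The vector space E is a type 'e with addition and an explicit scalar
multiplication sc, carrying a topology T with topspace T = UNIV.\<close>

definition nbhd :: "'a topology \<Rightarrow> 'a \<Rightarrow> 'a set \<Rightarrow> bool" where
  "nbhd X a W \<longleftrightarrow> W \<subseteq> topspace X \<and> (\<exists>G. openin X G \<and> a \<in> G \<and> G \<subseteq> W)"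

definition locally_convex_space ::
  "('k::real_normed_field \<Rightarrow> 'e::ab_group_add \<Rightarrow> 'e) \<Rightarrow> 'e topology \<Rightarrow> bool" where
  "locally_convex_space sc T \<longleftrightarrow>
     module sc \<and> topspace T = UNIV \<and> Hausdorff_space T \<and>
     continuous_map (prod_topology T T) T (\<lambda>(x, y). x + y) \<and>
     continuous_map (prod_topology euclidean T) T (\<lambda>(s, x). sc s x) \<and>
     (\<forall>W. openin T W \<and> 0 \<in> W \<longrightarrow>
        (\<exists>C. openin T C \<and> 0 \<in> C \<and> C \<subseteq> W \<and>
             (\<forall>x\<in>C. \<forall>y\<in>C. \<forall>t::real. 0 \<le> t \<and> t \<le> 1 \<longrightarrow>
                 sc (of_real t) x + sc (of_real (1 - t)) y \<in> C)))"

definition k_infty_space :: "'a topology \<Rightarrow> bool" where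
  "k_infty_space X \<longleftrightarrow> Hausdorff_space X \<and>
     (\<forall>n::nat. k_space (product_topology (\<lambda>_. X) {..<n}))"

definition ucc_topology :: "'a topology \<Rightarrow> ('a \<Rightarrow> 'k::real_normed_vector) set \<Rightarrow> ('a \<Rightarrow> 'k) topology" where
  "ucc_topology X S = topology_generated_by
     ({S} \<union> {{g \<in> S. \<forall>x\<in>C. norm (g x - f x) < e} | f C e. f \<in> S \<and> compactin X C \<and> e > 0})"

definition dual :: "('k::real_normed_field \<Rightarrow> 'e::ab_group_add \<Rightarrow> 'e) \<Rightarrow> 'e topology \<Rightarrow> ('e \<Rightarrow> 'k) set" where
  "dual sc T = {l. (\<forall>x y. l (x + y) = l x + l y) \<and> (\<forall>s x. l (sc s x) = s * l x) \<and>
                   continuous_map T euclidean l}"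

definition dual_c :: "('k::real_normed_field \<Rightarrow> 'e::ab_group_add \<Rightarrow> 'e) \<Rightarrow> 'e topology \<Rightarrow> ('e \<Rightarrow> 'k) topology" where
  "dual_c sc T = ucc_topology T (dual sc T)"

definition bidual :: "('k::real_normed_field \<Rightarrow> 'e::ab_group_add \<Rightarrow> 'e) \<Rightarrow> 'e topology \<Rightarrow> (('e \<Rightarrow> 'k) \<Rightarrow> 'k) set" where
  "bidual sc T = {\<phi> \<in> extensional (dual sc T).
      (\<forall>a\<in>dual sc T. \<forall>b\<in>dual sc T. \<phi> (\<lambda>x. a x + b x) = \<phi> a + \<phi> b) \<and>
      (\<forall>s. \<forall>a\<in>dual sc T. \<phi> (\<lambda>x. s * a x) = s * \<phi> a) \<and>
      continuous_map (dual_c sc T) euclidean \<phi>}"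

definition bidual_c :: "('k::real_normed_field \<Rightarrow> 'e::ab_group_add \<Rightarrow> 'e) \<Rightarrow> 'e topology \<Rightarrow> (('e \<Rightarrow> 'k) \<Rightarrow> 'k) topology" where
  "bidual_c sc T = ucc_topology (dual_c sc T) (bidual sc T)"

definition eval_map :: "('k::real_normed_field \<Rightarrow> 'e::ab_group_add \<Rightarrow> 'e) \<Rightarrow> 'e topology \<Rightarrow> 'e \<Rightarrow> (('e \<Rightarrow> 'k) \<Rightarrow> 'k)" where
  "eval_map sc T x = restrict (\<lambda>l. l x) (dual sc T)"

text \<open>Hypocontinuity of b : X x Y -> Z in the second argument w.r.t. compact subsets of Y
 (z0X, z0Z are the zero vectors of X and Z).\<close>
definition hypocontinuous2 ::
  "'a topology \<Rightarrow> 'b topology \<Rightarrow> 'c topology \<Rightarrow> ('a \<Rightarrow> 'b \<Rightarrow> 'c) \<Rightarrow> 'a \<Rightarrow> 'c \<Rightarrow> bool" where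
  "hypocontinuous2 X Y Z b z0X z0Z \<longleftrightarrow>
     (\<forall>y\<in>topspace Y. continuous_map X Z (\<lambda>x. b x y)) \<and>
     (\<forall>x\<in>topspace X. continuous_map Y Z (\<lambda>y. b x y)) \<and>
     (\<forall>M W. compactin Y M \<and> nbhd Z z0Z W \<longrightarrow>
        (\<exists>V. nbhd X z0X V \<and> (\<forall>v\<in>V. \<forall>m\<in>M. b v m \<in> W)))"

definition lc_poisson_space ::
  "('k::real_normed_field \<Rightarrow> 'e::ab_group_add \<Rightarrow> 'e) \<Rightarrow> 'e topology
     \<Rightarrow> (('e \<Rightarrow> 'k) \<Rightarrow> ('e \<Rightarrow> 'k) \<Rightarrow> ('e \<Rightarrow> 'k)) \<Rightarrow> bool" where
  "lc_poisson_space sc T br \<longleftrightarrow>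
     locally_convex_space sc T \<and> k_infty_space T \<and>
     embedding_map T (bidual_c sc T) (eval_map sc T) \<and>
     \<comment> \<open>bracket maps E' x E' into E'\<close>
     (\<forall>a\<in>dual sc T. \<forall>b\<in>dual sc T. br a b \<in> dual sc T) \<and>
     \<comment> \<open>bilinear\<close>
     (\<forall>a\<in>dual sc T. \<forall>b\<in>dual sc T. \<forall>c\<in>dual sc T.
         br (\<lambda>x. a x + b x) c = (\<lambda>x. br a c x + br b c x) \<and>
         br c (\<lambda>x. a x + b x) = (\<lambda>x. br c a x + br c b x)) \<and>
     (\<forall>s. \<forall>a\<in>dual sc T. \<forall>b\<in>dual sc T.
         br (\<lambda>x. s * a x) b = (\<lambda>x. s * br a b x) \<and>
         br a (\<lambda>x. s * b x) = (\<lambda>x. s * br a b x)) \<and>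
     \<comment> \<open>Lie algebra: alternating and Jacobi identity\<close>
     (\<forall>a\<in>dual sc T. br a a = (\<lambda>x. 0)) \<and>
     (\<forall>a\<in>dual sc T. \<forall>b\<in>dual sc T. \<forall>c\<in>dual sc T.
         (\<lambda>x. br a (br b c) x + br b (br c a) x + br c (br a b) x) = (\<lambda>x. 0)) \<and>
     hypocontinuous2 (dual_c sc T) (dual_c sc T) (dual_c sc T) br (\<lambda>x. 0) (\<lambda>x. 0) \<and>
     \<comment> \<open>eta_E(x) o [lambda, .] lies in eta_E(E)\<close>
     (\<forall>x. \<forall>l\<in>dual sc T. \<exists>y. \<forall>m\<in>dual sc T. eval_map sc T x (br l m) = eval_map sc T y m)"

text \<open>Iterated directional derivatives:
  iter_dd sc f k x ys = d^k f(x, ys 0, ..., ys (k-1)) = (D_{ys (k-1)} ... D_{ys 0} f)(x).\<close>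
primrec iter_dd :: "('k::real_normed_field \<Rightarrow> 'e::ab_group_add \<Rightarrow> 'e) \<Rightarrow> ('e \<Rightarrow> 'k) \<Rightarrow> nat \<Rightarrow> 'e \<Rightarrow> (nat \<Rightarrow> 'e) \<Rightarrow> 'k" where
  "iter_dd sc f 0 = (\<lambda>x ys. f x)"
| "iter_dd sc f (Suc k) = (\<lambda>x ys. Lim (at 0)
      (\<lambda>t. (iter_dd sc f k (x + sc t (ys k)) ys - iter_dd sc f k x ys) / t))"

definition dk_domain :: "'e topology \<Rightarrow> 'e set \<Rightarrow> nat \<Rightarrow> ('e \<times> (nat \<Rightarrow> 'e)) topology" where
  "dk_domain T U k = prod_topology (subtopology T U) (product_topology (\<lambda>_. T) {..<k})"

text \<open>C^\<infinity>_K in the sense of Bastiani: all iterated directional derivatives exist on U and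
  d^k f : U x E^k -> K is continuous for every k.\<close>
definition smooth_on :: "('k::real_normed_field \<Rightarrow> 'e::ab_group_add \<Rightarrow> 'e) \<Rightarrow> 'e topology \<Rightarrow> 'e set \<Rightarrow> ('e \<Rightarrow> 'k) \<Rightarrow> bool" where
  "smooth_on sc T U f \<longleftrightarrow>
     (\<forall>k. (\<forall>x\<in>U. \<forall>ys. ((\<lambda>t. (iter_dd sc f k (x + sc t (ys k)) ys - iter_dd sc f k x ys) / t)
                          \<longlongrightarrow> iter_dd sc f (Suc k) x ys) (at 0)) \<and>
          continuous_map (dk_domain T U k) euclidean (\<lambda>(x, ys). iter_dd sc f k x ys))"

definition Cinf :: "('k::real_normed_field \<Rightarrow> 'e::ab_group_add \<Rightarrow> 'e) \<Rightarrow> 'e topology \<Rightarrow> 'e set \<Rightarrow> ('e \<Rightarrow> 'k) set" where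
  "Cinf sc T U = {f \<in> extensional U. smooth_on sc T U f}"

text \<open>C^\<infinity>-topology: initial topology w.r.t. f \<mapsto> d^k f \<in> C(U x E^k, K), where the latter
  carries the compact-open topology (subbasis {h. h ` K \<subseteq> W}, K compact, W open).\<close>
definition Cinf_topology :: "('k::real_normed_field \<Rightarrow> 'e::ab_group_add \<Rightarrow> 'e) \<Rightarrow> 'e topology \<Rightarrow> 'e set \<Rightarrow> ('e \<Rightarrow> 'k) topology" where
  "Cinf_topology sc T U = topology_generated_by
     ({Cinf sc T U} \<union>
      {{g \<in> Cinf sc T U. (\<lambda>(x, ys). iter_dd sc g k x ys) ` K \<subseteq> W} | k K W.
          compactin (dk_domain T U k) K \<and> open W})"

definition fderiv1 :: "('k::real_normed_field \<Rightarrow> 'e::ab_group_add \<Rightarrow> 'e) \<Rightarrow> ('e \<Rightarrow> 'k) \<Rightarrow> 'e \<Rightarrow> ('e \<Rightarrow> 'k)" where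
  "fderiv1 sc f x = (\<lambda>y. iter_dd sc f 1 x (\<lambda>_. y))"

definition poisson_bracket ::
  "('k::real_normed_field \<Rightarrow> 'e::ab_group_add \<Rightarrow> 'e) \<Rightarrow> (('e \<Rightarrow> 'k) \<Rightarrow> ('e \<Rightarrow> 'k) \<Rightarrow> ('e \<Rightarrow> 'k))
     \<Rightarrow> 'e set \<Rightarrow> ('e \<Rightarrow> 'k) \<Rightarrow> ('e \<Rightarrow> 'k) \<Rightarrow> ('e \<Rightarrow> 'k)" where
  "poisson_bracket sc br U f g = restrict (\<lambda>x. br (fderiv1 sc f x) (fderiv1 sc g x) x) U"

end

theory Submission
  imports Defs
begin

text \<open>Write \<open>F\<^sub>I(x, y)\<close> for the functional \<open>z \<mapsto> d^{|I|+1} f(x, z, y\<^sub>I)\<close> in \<open>E'\<close>.  It is continuous in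
\<open>(x, y)\<close> and differentiable in \<open>x\<close> as a map into \<open>E'\<^sub>c\<close>, so by the Leibniz rule \<open>d^k {f, g}(x, y)\<close> is a
sum of terms \<open>[F\<^sub>I(x, y), G\<^sub>J(x, y)](u)\<close> with \<open>u\<close> equal to \<open>x\<close> or to some \<open>y\<^sub>i\<close>.  Hypocontinuity and
antisymmetry give convergence of \<open>[\<lambda>\<^sub>i, \<mu>\<^sub>i]\<close> whenever \<open>\<lambda>\<^sub>i\<close> and \<open>\<mu>\<^sub>i\<close> converge and one of
the two nets stays in a compact set.  As \<open>(f, x, y) \<mapsto> F\<^sub>I(x, y)\<close> is continuous when \<open>(x, y)\<close> is confined
to a compact set, all continuity claims follow on compact sets; the \<open>k^\<infinity>\<close>-property makes
\<open>d^k {f, g}\<close> continuous on all of \<open>U \<times> E^k\<close>.\<close>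

section \<open>Limits and compactness\<close>

text \<open>The bracket on \<open>E'\<^sub>c\<close> and the evaluation pairing of
  \<open>E'\<^sub>c\<close> with \<open>E\<close> are in general only hypocontinuous, so composing
  them with continuous maps need not give a continuous map. Every limit therefore has to be supplied
  with compact sets. For the Leibniz rule they come from the scalar variable: a limit as
  \<open>t\<close> tends to 0 can be tested on sequences, and a convergent sequence together with
  its limit is compact. For continuity they come from confining the argument of
  \<open>d^k {f, g}\<close> to a compact subset of \<open>U \<times> E^k\<close>, whose image under
  the jets of a compact set of functions is compact in \<open>E'\<^sub>c\<close>. Continuity is
  phrased as convergence along neighbourhood filters, so that one limit theorem, with
  \<open>f\<close>, \<open>g\<close> and the point varying simultaneously, serves for smoothness,
  for hypocontinuity and for the continuous case.\<close>

lemma continuous_map_iff_limitin: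
  "continuous_map X Y f \<longleftrightarrow> (\<forall>x\<in>topspace X. limitin Y f (f x) (nhdsin X x))"
proof
  assume f: "continuous_map X Y f"
  show "\<forall>x\<in>topspace X. limitin Y f (f x) (nhdsin X x)"
  proof
    fix x assume x: "x \<in> topspace X"
    show "limitin Y f (f x) (nhdsin X x)"
      unfolding limitin_def
    proof (intro conjI allI impI)
      show "f x \<in> topspace Y" using continuous_map_image_subset_topspace[OF f] x by auto
      fix V assume V: "openin Y V \<and> f x \<in> V"
      have "openin X {x \<in> topspace X. f x \<in> V}"
        using V f by (simp add: continuous_map_def)
      then show "\<forall>\<^sub>F x in nhdsin X x. f x \<in> V"
        unfolding eventually_nhdsin using V x by blast
    qed
  qed
next
  assume lim: "\<forall>x\<in>topspace X. limitin Y f (f x) (nhdsin X x)"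
  show "continuous_map X Y f"
    unfolding continuous_map_def
  proof (intro conjI allI impI)
    show "f \<in> topspace X \<rightarrow> topspace Y" using lim limitin_topspace by fastforce
    fix V assume V: "openin Y V"
    show "openin X {x \<in> topspace X. f x \<in> V}"
    proof (subst openin_subopen, intro ballI)
      fix x assume x: "x \<in> {x \<in> topspace X. f x \<in> V}"
      then have "\<forall>\<^sub>F x in nhdsin X x. f x \<in> V"
        using lim V limitinD by fastforce
      then obtain G where "openin X G" "x \<in> G" "\<forall>y\<in>G. f y \<in> V"
        unfolding eventually_nhdsin using x by auto
      then show "\<exists>G. openin X G \<and> x \<in> G \<and> G \<subseteq> {x \<in> topspace X. f x \<in> V}"
        using openin_subset by blast
    qed
  qed
qed

lemma continuous_map_limitin:
  assumes "continuous_map X Y f" "limitin X g l F"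
  shows "limitin Y (\<lambda>a. f (g a)) (f l) F"
  using continuous_map_limit[OF assms] by (simp add: o_def)

lemma limitin_id_nhdsin: "x \<in> topspace X \<Longrightarrow> limitin X (\<lambda>a. a) x (nhdsin X x)"
  using continuous_map_iff_limitin[of X X "\<lambda>a. a"] by simp

lemma limitin_prod_topologyI:
  "limitin X f a F \<Longrightarrow> limitin Y g b F \<Longrightarrow> limitin (prod_topology X Y) (\<lambda>x. (f x, g x)) (a, b) F"
  by (simp add: limitin_pairwise o_def)

lemma limitin_prod_filter1:
  "limitin X f l A \<Longrightarrow> limitin X (\<lambda>p. f (fst p)) l (A \<times>\<^sub>F B)"
  unfolding limitin_def using filterlim_fst[of A B] by (auto simp: filterlim_iff)

lemma limitin_prod_filter2:
  "limitin X f l B \<Longrightarrow> limitin X (\<lambda>p. f (snd p)) l (A \<times>\<^sub>F B)"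
  unfolding limitin_def using filterlim_snd[of B A] by (auto simp: filterlim_iff)

lemma eventually_prod_filter1:
  "eventually P A \<Longrightarrow> eventually (\<lambda>p. P (fst p)) (A \<times>\<^sub>F B)"
  using filterlim_fst[of A B] by (auto simp: filterlim_iff)

lemma eventually_prod_filter2:
  "eventually P B \<Longrightarrow> eventually (\<lambda>p. P (snd p)) (A \<times>\<^sub>F B)"
  using filterlim_snd[of B A] by (auto simp: filterlim_iff)

lemma eventually_nhdsin_topspace: "\<forall>\<^sub>F x in nhdsin X a. x \<in> topspace X"
  unfolding eventually_nhdsin by auto

lemma eventually_nhdsin_subtopology: "\<forall>\<^sub>F x in nhdsin (subtopology X K) a. x \<in> K"
  using eventually_nhdsin_topspace[of "subtopology X K" a] by (auto elim: eventually_mono)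

lemma limitin_id_nhdsin_subtopology:
  assumes "K \<subseteq> topspace X" "x \<in> K"
  shows "limitin X (\<lambda>a. a) x (nhdsin (subtopology X K) x)"
  using limitin_id_nhdsin[of x "subtopology X K"] assms by (auto simp: limitin_subtopology)

text \<open>A tube lemma for filters: each point of \<open>K\<close> has a relative neighbourhood on
  which \<open>Q\<close> holds for a common eventual set of indices, and finitely many of these
  neighbourhoods cover \<open>K\<close>. It turns a joint limit in an index and a point into a limit
  that is uniform on the compact set.\<close>

lemma eventually_compactin:
  assumes K: "compactin X K"
    and ev: "\<And>x. x \<in> K \<Longrightarrow> \<forall>\<^sub>F p in A \<times>\<^sub>F nhdsin (subtopology X K) x. Q (fst p) (snd p)"
  shows "\<forall>\<^sub>F i in A. \<forall>x\<in>K. Q i x"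
proof -
  have KX: "K \<subseteq> topspace X" using K compactin_subset_topspace by blast
  have "\<exists>P S. eventually P A \<and> openin X S \<and> x \<in> S \<and> (\<forall>i y. P i \<longrightarrow> y \<in> S \<inter> K \<longrightarrow> Q i y)"
    if x: "x \<in> K" for x
  proof -
    obtain P R where P: "eventually P A" and R: "eventually R (nhdsin (subtopology X K) x)"
      and PR: "\<And>i y. P i \<Longrightarrow> R y \<Longrightarrow> Q i y"
      using ev[OF x] unfolding eventually_prod_filter by auto
    obtain S where S: "openin (subtopology X K) S" "x \<in> S" "\<forall>y\<in>S. R y"
      using R x KX unfolding eventually_nhdsin by auto
    then obtain S' where "openin X S'" "S = S' \<inter> K" unfolding openin_subtopology by auto
    with S P PR show ?thesis by blast
  qed
  then obtain P S where PS: "\<And>x. x \<in> K \<Longrightarrow> eventually (P x) A \<and> openin X (S x) \<and> x \<in> S x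
      \<and> (\<forall>i y. P x i \<longrightarrow> y \<in> S x \<inter> K \<longrightarrow> Q i y)"
    by metis
  have "\<exists>\<F>. finite \<F> \<and> \<F> \<subseteq> S ` K \<and> K \<subseteq> \<Union>\<F>"
  proof -
    have "\<forall>G\<in>S ` K. openin X G" "K \<subseteq> \<Union>(S ` K)" using PS by auto
    then show ?thesis using K unfolding compactin_def by blast
  qed
  then obtain C where C: "C \<subseteq> K" "finite C" "K \<subseteq> \<Union>(S ` C)"
    by (metis finite_subset_image)
  have "\<forall>\<^sub>F i in A. \<forall>x\<in>C. P x i"
    using C PS by (intro eventually_ball_finite) auto
  then show ?thesis
  proof (rule eventually_mono)
    fix i assume "\<forall>x\<in>C. P x i"
    then show "\<forall>x\<in>K. Q i x" using C PS by blast
  qed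
qed

text \<open>This supplies the compact sets for limits along sequences. Convergence says nothing
  about finitely many terms, which may lie outside the space; hence the intersection with
  \<open>topspace X\<close>.\<close>

lemma limitin_compact_tail:
  assumes lim: "limitin X s l sequentially"
  shows "\<exists>M. compactin X M \<and> (\<forall>\<^sub>F n in sequentially. s n \<in> M)"
proof (intro exI conjI)
  show "compactin X (insert l (range s \<inter> topspace X))"
    by (rule compactin_sequence_with_limit[OF lim]) auto
  have "\<forall>\<^sub>F n in sequentially. s n \<in> topspace X"
    by (rule limitinD[OF lim openin_topspace limitin_topspace[OF lim]])
  then show "\<forall>\<^sub>F n in sequentially. s n \<in> insert l (range s \<inter> topspace X)"
    by (rule eventually_mono) auto
qed

section \<open>Convergence in topologies given by a subbasis\<close>

lemma limitin_topology_generated_by: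
  "limitin (topology_generated_by S) f l F \<longleftrightarrow>
    l \<in> \<Union>S \<and> (\<forall>s\<in>S. l \<in> s \<longrightarrow> eventually (\<lambda>x. f x \<in> s) F)"
proof
  assume L: "limitin (topology_generated_by S) f l F"
  then show "l \<in> \<Union>S \<and> (\<forall>s\<in>S. l \<in> s \<longrightarrow> eventually (\<lambda>x. f x \<in> s) F)"
    using limitin_topspace[OF L] limitinD[OF L] topology_generated_by_Basis[of _ S]
    by (auto simp: topology_generated_by_topspace)
next
  assume R: "l \<in> \<Union>S \<and> (\<forall>s\<in>S. l \<in> s \<longrightarrow> eventually (\<lambda>x. f x \<in> s) F)"
  have "eventually (\<lambda>x. f x \<in> G) F" if "generate_topology_on S G" "l \<in> G" for G
    using that
  proof (induction rule: generate_topology_on.induct)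
    case (Int a b)
    then show ?case by (auto intro: eventually_conj)
  next
    case (UN K)
    then obtain k where "k \<in> K" "l \<in> k" by auto
    with UN have "\<forall>\<^sub>F x in F. f x \<in> k" by auto
    then show ?case by (rule eventually_mono) (use \<open>k \<in> K\<close> in auto)
  qed (use R in auto)
  then show "limitin (topology_generated_by S) f l F"
    using R unfolding limitin_def
    by (auto simp: topology_generated_by_topspace openin_topology_generated_by_iff)
qed

text \<open>The subbasic sets are balls around arbitrary \<open>h\<close> in \<open>S\<close>, not
  only around the limit \<open>l\<close>. If \<open>l\<close> lies in such a ball over a nonempty
  compact set \<open>C\<close>, continuity makes \<open>norm (l x - h x)\<close> attain its maximum
  there, which is below \<open>e\<close>; the remaining margin \<open>d\<close> is the radius of a
  ball around \<open>l\<close> inside the given one.\<close>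

lemma limitin_ucc_topology:
  fixes S :: "('a \<Rightarrow> 'k::real_normed_vector) set"
  assumes cont: "\<And>f. f \<in> S \<Longrightarrow> continuous_map X euclidean f"
  shows "limitin (ucc_topology X S) f l F \<longleftrightarrow> l \<in> S \<and> (\<forall>\<^sub>F i in F. f i \<in> S) \<and>
     (\<forall>C e. compactin X C \<longrightarrow> e > 0 \<longrightarrow> (\<forall>\<^sub>F i in F. \<forall>x\<in>C. norm (f i x - l x) < e))"
    (is "?L \<longleftrightarrow> ?R")
proof
  assume L: ?L
  note L' = L[unfolded ucc_topology_def limitin_topology_generated_by]
  have l: "l \<in> S" using L' by blast
  moreover have "\<forall>\<^sub>F i in F. f i \<in> S" using L' l by blast
  moreover have "\<forall>\<^sub>F i in F. \<forall>x\<in>C. norm (f i x - l x) < e" if C: "compactin X C" and e: "e > 0" for C e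
  proof -
    have "\<forall>\<^sub>F i in F. f i \<in> {g \<in> S. \<forall>x\<in>C. norm (g x - l x) < e}"
      using l e C by (intro L'[THEN conjunct2, rule_format]) auto
    then show ?thesis by (rule eventually_mono) auto
  qed
  ultimately show ?R by blast
next
  assume R: ?R
  then have l: "l \<in> S" by blast
  have main: "\<forall>\<^sub>F i in F. f i \<in> {g \<in> S. \<forall>x\<in>C. norm (g x - h x) < e}"
    if h: "h \<in> S" and C: "compactin X C" and lh: "\<forall>x\<in>C. norm (l x - h x) < e" for h C e
  proof -
    have "\<exists>d>0. \<forall>x\<in>C. norm (l x - h x) + d \<le> e"
    proof (cases "C = {}")
      case False
      have "continuous_map X euclidean (\<lambda>x. norm (l x - h x))"
        using cont[OF l] cont[OF h] by (intro continuous_intros)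
      then have "compact ((\<lambda>x. norm (l x - h x)) ` C)"
        using image_compactin[OF C] by force
      then obtain x where "x \<in> C" "\<forall>y\<in>C. norm (l y - h y) \<le> norm (l x - h x)"
        using compact_attains_sup[of "(\<lambda>x. norm (l x - h x)) ` C"] False by auto
      then show ?thesis using lh by (intro exI[of _ "e - norm (l x - h x)"]) auto
    qed (auto intro: exI[of _ 1])
    then obtain d where d: "d > 0" "\<forall>x\<in>C. norm (l x - h x) + d \<le> e" by blast
    have "\<forall>\<^sub>F i in F. f i \<in> S \<and> (\<forall>x\<in>C. norm (f i x - l x) < d)"
      using R C d by (auto intro: eventually_conj)
    then show ?thesis
    proof (rule eventually_mono)
      fix i assume i: "f i \<in> S \<and> (\<forall>x\<in>C. norm (f i x - l x) < d)"
      have "norm (f i x - h x) < e" if "x \<in> C" for x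
        using i d norm_triangle_ineq[of "f i x - l x" "l x - h x"] that by fastforce
      then show "f i \<in> {g \<in> S. \<forall>x\<in>C. norm (g x - h x) < e}" using i by auto
    qed
  qed
  show ?L
    unfolding ucc_topology_def limitin_topology_generated_by
    using R l main by auto
qed

section \<open>Iterated directional derivatives\<close>

declare iter_dd.simps [simp del]

lemma iter_dd_cong:
  "(\<And>i. i < k \<Longrightarrow> ys i = zs i) \<Longrightarrow> iter_dd sc f k x ys = iter_dd sc f k x zs"
  by (induction k arbitrary: x) (simp_all add: iter_dd.simps)

locale open_in_lcs =
  fixes sc :: "'k::real_normed_field \<Rightarrow> 'e::ab_group_add \<Rightarrow> 'e"
    and T :: "'e topology" and U :: "'e set"
  assumes lcs: "locally_convex_space sc T" and open_U: "openin T U"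
begin

sublocale module sc
  using lcs unfolding locally_convex_space_def by blast

lemma topspace_T [simp]: "topspace T = UNIV"
  using lcs unfolding locally_convex_space_def by blast

lemma limitin_add:
  assumes "limitin T f a F" "limitin T g b F"
  shows "limitin T (\<lambda>x. f x + g x) (a + b) F"
proof -
  have "continuous_map (prod_topology T T) T (\<lambda>(x, y). x + y)"
    using lcs unfolding locally_convex_space_def by blast
  from continuous_map_limitin[OF this limitin_prod_topologyI[OF assms]] show ?thesis by simp
qed

lemma limitin_scale:
  assumes "(f \<longlongrightarrow> a) F" "limitin T g b F"
  shows "limitin T (\<lambda>x. sc (f x) (g x)) (sc a b) F"
proof -
  have c: "continuous_map (prod_topology euclidean T) T (\<lambda>(s, x). sc s x)"
    using lcs unfolding locally_convex_space_def by blast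
  have "limitin euclidean f a F" using assms by simp
  from continuous_map_limitin[OF c limitin_prod_topologyI[OF this assms(2)]] show ?thesis by simp
qed

lemma limitin_line: "limitin T (\<lambda>t. x + sc t w) x (at 0)"
proof -
  have "limitin T (\<lambda>t. x + sc t w) (x + sc 0 w) (at 0)"
    by (intro limitin_add limitin_scale tendsto_ident_at) auto
  then show ?thesis by simp
qed

lemma eventually_in_U: "limitin T f a F \<Longrightarrow> a \<in> U \<Longrightarrow> \<forall>\<^sub>F x in F. f x \<in> U"
  using limitinD open_U by metis

lemma eventually_line_in_U: "x \<in> U \<Longrightarrow> \<forall>\<^sub>F t in at 0. x + sc t w \<in> U"
  using eventually_in_U limitin_line by blast

lemma smooth_on_derivative:
  "smooth_on sc T U f \<Longrightarrow> x \<in> U \<Longrightarrow>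
    ((\<lambda>t. (iter_dd sc f k (x + sc t (ys k)) ys - iter_dd sc f k x ys) / t)
      \<longlongrightarrow> iter_dd sc f (Suc k) x ys) (at 0)"
  unfolding smooth_on_def by blast

lemma topspace_dk_domain: "topspace (dk_domain T U k) = U \<times> extensional {..<k}"
  unfolding dk_domain_def using openin_subset[OF open_U] by (auto simp: PiE_def)

lemma limitin_dk_domain:
  assumes "limitin T X x F" "x \<in> U" "\<And>i. i < k \<Longrightarrow> limitin T (\<lambda>a. Y a i) (y i) F"
  shows "limitin (dk_domain T U k) (\<lambda>a. (X a, restrict (Y a) {..<k})) (x, restrict y {..<k}) F"
  unfolding dk_domain_def
proof (rule limitin_prod_topologyI)
  show "limitin (subtopology T U) X x F"
    using assms eventually_in_U by (auto simp: limitin_subtopology)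
  show "limitin (product_topology (\<lambda>_. T) {..<k}) (\<lambda>a. restrict (Y a) {..<k}) (restrict y {..<k}) F"
    using assms(3) by (auto simp: limitin_componentwise)
qed

lemma limitin_dk_domain_fst: "limitin (dk_domain T U k) p q F \<Longrightarrow> limitin T (\<lambda>a. fst (p a)) (fst q) F"
  by (simp add: dk_domain_def limitin_pairwise limitin_subtopology o_def)

lemma limitin_dk_domain_snd:
  "limitin (dk_domain T U k) p q F \<Longrightarrow> i < k \<Longrightarrow> limitin T (\<lambda>a. snd (p a) i) (snd q i) F"
  by (simp add: dk_domain_def limitin_pairwise limitin_componentwise o_def)

text \<open>Points of the product topology are extensional tuples, while \<open>iter_dd\<close>
  takes total sequences. Only the entries below \<open>k\<close> matter, so convergence of these
  suffices and the restriction disappears again.\<close>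

lemma tendsto_iter_dd:
  assumes f: "smooth_on sc T U f" and X: "limitin T X x F" "x \<in> U"
    and Y: "\<And>i. i < k \<Longrightarrow> limitin T (\<lambda>a. Y a i) (y i) F"
  shows "((\<lambda>a. iter_dd sc f k (X a) (Y a)) \<longlongrightarrow> iter_dd sc f k x y) F"
proof -
  have c: "continuous_map (dk_domain T U k) euclidean (\<lambda>(x, ys). iter_dd sc f k x ys)"
    using f unfolding smooth_on_def by blast
  have "limitin euclidean (\<lambda>a. iter_dd sc f k (X a) (restrict (Y a) {..<k}))
      (iter_dd sc f k x (restrict y {..<k})) F"
    using continuous_map_limitin[OF c limitin_dk_domain[OF X Y]] by simp
  moreover have "iter_dd sc f k z (restrict w {..<k}) = iter_dd sc f k z w" for z w
    by (rule iter_dd_cong) auto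
  ultimately show ?thesis by simp
qed

text \<open>The base point of the difference quotient moves along \<open>v\<close>; this yields additivity
of the differential as well as differentiability of \<open>x \<mapsto> d^k f(x, \<cdot>)\<close> uniformly on compact sets.\<close>

lemma difference_quotient_uniform:
  assumes f: "smooth_on sc T U f" and x: "x \<in> U" and L: "compactin T L" and e: "e > 0"
    and Y: "\<And>i. i < n \<Longrightarrow> continuous_map T T (\<lambda>z. Y z i)" and w: "\<And>z. Y z n = w"
  shows "\<forall>\<^sub>F t in at 0. \<forall>z\<in>L.
      norm ((iter_dd sc f n (x + sc t v + sc t w) (Y z) - iter_dd sc f n (x + sc t v) (Y z)) / t
        - iter_dd sc f (Suc n) x (Y z)) < e"
proof -
  let ?D = "iter_dd sc f (Suc n)"
  \<comment> \<open>The first parameter moves the base point along \<open>v\<close>, the second will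
    run through the segment from 0 to \<open>t\<close> in direction \<open>w\<close>. Since the
    second may vanish, full neighbourhoods of 0 are used instead of punctured ones.\<close>
  have base: "limitin T (\<lambda>q. x + sc (fst q) v + sc (snd q) w) x (nhds 0 \<times>\<^sub>F nhds 0)"
  proof -
    have "limitin T (\<lambda>q. x + sc (fst q) v + sc (snd q) w) (x + sc 0 v + sc 0 w) (nhds 0 \<times>\<^sub>F nhds 0)"
      by (intro limitin_add limitin_scale filterlim_fst filterlim_snd) auto
    then show ?thesis by simp
  qed
  have "\<forall>\<^sub>F q in nhds 0 \<times>\<^sub>F nhds 0. \<forall>z\<in>L.
      norm (?D (x + sc (fst q) v + sc (snd q) w) (Y z) - ?D x (Y z)) < e / 2"
  proof (rule eventually_compactin[OF L])
    fix z assume z: "z \<in> L"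
    let ?F = "(nhds 0 \<times>\<^sub>F nhds 0) \<times>\<^sub>F nhdsin (subtopology T L) z"
    have Yl: "limitin T (\<lambda>a. Y (snd a) i) (Y z i) ?F" if "i < Suc n" for i
    proof (cases "i = n")
      case False
      then have "limitin T (\<lambda>z. Y z i) (Y z i) (nhdsin (subtopology T L) z)"
        using continuous_map_limitin[OF Y limitin_id_nhdsin_subtopology[of L T z]] that z by auto
      from limitin_prod_filter2[OF this] show ?thesis .
    qed (simp add: w)
    have "((\<lambda>a. ?D (x + sc (fst (fst a)) v + sc (snd (fst a)) w) (Y (snd a))) \<longlongrightarrow> ?D x (Y z)) ?F"
      by (rule tendsto_iter_dd[OF f limitin_prod_filter1[OF base] x Yl])
    moreover have "((\<lambda>a. ?D x (Y (snd a))) \<longlongrightarrow> ?D x (Y z)) ?F"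
      by (rule tendsto_iter_dd[OF f _ x Yl]) auto
    ultimately have "((\<lambda>a. ?D (x + sc (fst (fst a)) v + sc (snd (fst a)) w) (Y (snd a)) - ?D x (Y (snd a)))
        \<longlongrightarrow> ?D x (Y z) - ?D x (Y z)) ?F"
      by (rule tendsto_diff)
    from tendstoD[OF this, of "e / 2"]
    show "\<forall>\<^sub>F a in ?F. norm (?D (x + sc (fst (fst a)) v + sc (snd (fst a)) w) (Y (snd a))
        - ?D x (Y (snd a))) < e / 2"
      using e by simp
  qed
  with eventually_in_U[OF base x]
  have "\<forall>\<^sub>F q in nhds 0 \<times>\<^sub>F nhds 0. x + sc (fst q) v + sc (snd q) w \<in> U \<and> (\<forall>z\<in>L.
      norm (?D (x + sc (fst q) v + sc (snd q) w) (Y z) - ?D x (Y z)) < e / 2)"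
    by (rule eventually_conj)
  then obtain P where P: "eventually P (nhds (0::'k))"
    and PP: "\<And>t u. P t \<Longrightarrow> P u \<Longrightarrow> x + sc t v + sc u w \<in> U \<and> (\<forall>z\<in>L.
      norm (?D (x + sc t v + sc u w) (Y z) - ?D x (Y z)) < e / 2)"
    unfolding eventually_prod_same by auto
  obtain d where d: "d > 0" "\<And>t. norm t < d \<Longrightarrow> P t"
    using P by (auto simp: eventually_nhds_metric)
  have "\<forall>\<^sub>F t in at (0::'k). norm t < d \<and> t \<noteq> 0"
    using d by (auto simp: eventually_at)
  then show ?thesis
  proof (rule eventually_mono)
    fix t :: 'k assume t: "norm t < d \<and> t \<noteq> 0"
    show "\<forall>z\<in>L. norm ((iter_dd sc f n (x + sc t v + sc t w) (Y z) - iter_dd sc f n (x + sc t v) (Y z)) / t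
        - iter_dd sc f (Suc n) x (Y z)) < e"
    proof
      fix z assume z: "z \<in> L"
      define c where "c = ?D x (Y z)"
      \<comment> \<open>The mean value inequality is applied to \<open>\<phi> u - u * c\<close>: its
        derivative, the directional derivative at the shifted point minus \<open>c\<close>, is at
        most \<open>e / 2\<close> in norm along the segment. Halving \<open>e\<close> leaves room
        for the strict inequality.\<close>
      define \<phi> where "\<phi> = (\<lambda>u. iter_dd sc f n (x + sc t v + sc u w) (Y z))"
      have Pu: "P u" if "u \<in> closed_segment 0 t" for u
        using segment_bound1[OF that] t d by simp
      have "norm ((\<phi> t - t * c) - (\<phi> 0 - 0 * c)) \<le> e / 2 * norm (t - 0)"
      proof (rule field_differentiable_bound[where S = "closed_segment 0 t" and
            f' = "\<lambda>u. ?D (x + sc t v + sc u w) (Y z) - c" and f = "\<lambda>u. \<phi> u - u * c"])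
        fix u assume u: "u \<in> closed_segment 0 t"
        have U: "x + sc t v + sc u w \<in> U" using PP Pu[OF u] d t by blast
        have "(\<phi> has_field_derivative ?D (x + sc t v + sc u w) (Y z)) (at u)"
          using smooth_on_derivative[OF f U, of n "Y z"]
          by (simp add: DERIV_def \<phi>_def w scale_left_distrib add.assoc)
        then show "((\<lambda>u. \<phi> u - u * c) has_field_derivative ?D (x + sc t v + sc u w) (Y z) - c)
            (at u within closed_segment 0 t)"
          by (auto intro!: derivative_eq_intros intro: has_field_derivative_at_within)
        show "norm (?D (x + sc t v + sc u w) (Y z) - c) \<le> e / 2"
          unfolding c_def using PP[of t u] Pu[OF u] d t z by fastforce
      qed auto
      then have *: "norm (\<phi> t - \<phi> 0 - t * c) \<le> e / 2 * norm t" by (simp add: algebra_simps)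
      have "(\<phi> t - \<phi> 0) / t - c = (\<phi> t - \<phi> 0 - t * c) / t"
        using t by (simp add: field_simps)
      then have "norm ((\<phi> t - \<phi> 0) / t - c) = norm (\<phi> t - \<phi> 0 - t * c) / norm t"
        by (simp add: norm_divide)
      also have "\<dots> \<le> e / 2" using * t by (simp add: divide_simps)
      also have "\<dots> < e" using e by simp
      finally show "norm ((iter_dd sc f n (x + sc t v + sc t w) (Y z) - iter_dd sc f n (x + sc t v) (Y z)) / t
          - iter_dd sc f (Suc n) x (Y z)) < e"
        by (simp add: \<phi>_def c_def)
    qed
  qed
qed

end

text \<open>The linear functional \<open>z \<mapsto> d^k f(x, z, ys I)\<close>.  Placing the free direction first makes
linearity and differentiability immediate by induction on the remaining directions, so that the
symmetry of higher derivatives is not needed.\<close>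

definition jet :: "('k::real_normed_field \<Rightarrow> 'e::ab_group_add \<Rightarrow> 'e) \<Rightarrow> ('e \<Rightarrow> 'k) \<Rightarrow> nat list
    \<Rightarrow> 'e \<times> (nat \<Rightarrow> 'e) \<Rightarrow> 'e \<Rightarrow> 'k" where
  "jet sc f I p = (\<lambda>z. iter_dd sc f (Suc (length I)) (fst p) (case_nat z (\<lambda>m. snd p (I ! m))))"

lemma fderiv1_eq_jet: "fderiv1 sc f x = jet sc f [] (x, ys)"
  unfolding fderiv1_def jet_def by (intro ext, simp, intro iter_dd_cong) simp

lemma dual_add: "a \<in> dual sc T \<Longrightarrow> b \<in> dual sc T \<Longrightarrow> (\<lambda>x. a x + b x) \<in> dual sc T"
  unfolding dual_def continuous_map_iff_limitin
  by (auto intro: tendsto_add simp: algebra_simps)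

lemma dual_scale: "a \<in> dual sc T \<Longrightarrow> (\<lambda>x. s * a x) \<in> dual sc T"
  unfolding dual_def continuous_map_iff_limitin
  by (auto intro: tendsto_mult_left simp: algebra_simps)

lemma dual_diff_divide:
  assumes "a \<in> dual sc T" "b \<in> dual sc T"
  shows "(\<lambda>x. (a x - b x) / t) \<in> dual sc T"
  using dual_scale[OF dual_add[OF assms(1) dual_scale[OF assms(2), of "-1"]], of "inverse t"]
  by (simp add: field_simps)

section \<open>Jets as elements of the dual\<close>

context open_in_lcs
begin

text \<open>The index \<open>k\<close> goes to the end of \<open>I\<close> because
  \<open>iter_dd\<close> differentiates last in the direction with the highest index;
  differentiating the jet thus raises the order by one and leaves the free direction
  \<open>z\<close> in slot 0. Uniformity in \<open>z\<close> over compact sets is what convergence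
  in \<open>E'\<^sub>c\<close> asks for.\<close>

lemma jet_derivative_uniform:
  assumes f: "smooth_on sc T U f" and x: "x \<in> U" and L: "compactin T L" and e: "e > 0"
  shows "\<forall>\<^sub>F t in at 0. \<forall>z\<in>L. norm ((jet sc f I (x + sc t (ys k), ys) z - jet sc f I (x, ys) z) / t
    - jet sc f (I @ [k]) (x, ys) z) < e"
proof -
  define Y where "Y = (\<lambda>z. case_nat z (\<lambda>m. ys ((I @ [k]) ! m)))"
  have jet: "jet sc f I (u, ys) z = iter_dd sc f (Suc (length I)) u (Y z)" for u z
    unfolding jet_def Y_def fst_conv snd_conv
    by (rule iter_dd_cong) (auto simp: nth_append split: nat.split)
  have jet': "jet sc f (I @ [k]) (u, ys) z = iter_dd sc f (Suc (Suc (length I))) u (Y z)" for u z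
    unfolding jet_def Y_def by simp
  have "\<forall>\<^sub>F t in at 0. \<forall>z\<in>L.
      norm ((iter_dd sc f (Suc (length I)) (x + sc t 0 + sc t (ys k)) (Y z)
        - iter_dd sc f (Suc (length I)) (x + sc t 0) (Y z)) / t
        - iter_dd sc f (Suc (Suc (length I))) x (Y z)) < e"
  proof (rule difference_quotient_uniform[OF f x L e])
    show "continuous_map T T (\<lambda>z. Y z i)" for i
      by (cases i) (auto simp: Y_def)
    show "Y z (Suc (length I)) = ys k" for z by (simp add: Y_def)
  qed
  then show ?thesis by (simp add: jet jet')
qed

lemma jet_derivative:
  assumes "smooth_on sc T U f" "x \<in> U"
  shows "((\<lambda>t. (jet sc f I (x + sc t (ys k), ys) z - jet sc f I (x, ys) z) / t)
    \<longlongrightarrow> jet sc f (I @ [k]) (x, ys) z) (at 0)"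
  unfolding tendsto_iff dist_norm
  using jet_derivative_uniform[OF assms, of "{z}"] by simp

text \<open>Split the increment of \<open>f\<close> from \<open>x\<close> to
  \<open>x + sc t (y + z)\<close> at the point \<open>x + sc t y\<close>. The increment in direction
  \<open>z\<close> then starts from a base point that moves with \<open>t\<close>, so existence of
  directional derivatives at \<open>x\<close> alone would not do.\<close>

lemma jet_Nil_add:
  assumes f: "smooth_on sc T U f" and x: "x \<in> U"
  shows "jet sc f [] (x, ys) (y + z) = jet sc f [] (x, ys) y + jet sc f [] (x, ys) z"
proof -
  have D: "((\<lambda>t. (f (x + sc t v + sc t w) - f (x + sc t v)) / t) \<longlongrightarrow> jet sc f [] (x, ys) w) (at 0)"
    for v w
  proof -
    have "jet sc f [] (x, ys) w = iter_dd sc f (Suc 0) x (\<lambda>_. w)"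
      by (simp add: fderiv1_eq_jet[symmetric] fderiv1_def)
    then show ?thesis
      unfolding tendsto_iff dist_norm
      using difference_quotient_uniform[OF f x, of "{w}" _ 0 "\<lambda>z _. w" w v]
      by (simp add: iter_dd.simps(1))
  qed
  have "((\<lambda>t. (f (x + sc t y + sc t z) - f (x + sc t y)) / t + (f (x + sc t 0 + sc t y) - f (x + sc t 0)) / t)
      \<longlongrightarrow> jet sc f [] (x, ys) z + jet sc f [] (x, ys) y) (at 0)"
    by (intro tendsto_add D)
  also have "(\<lambda>t. (f (x + sc t y + sc t z) - f (x + sc t y)) / t + (f (x + sc t 0 + sc t y) - f (x + sc t 0)) / t)
      = (\<lambda>t. (f (x + sc t 0 + sc t (y + z)) - f (x + sc t 0)) / t)"
    by (simp add: scale_right_distrib add.assoc flip: add_divide_distrib)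
  finally show ?thesis
    using tendsto_unique[OF _ D[of 0 "y + z"]] by (simp add: add.commute)
qed

lemma jet_Nil_scale:
  assumes f: "smooth_on sc T U f" and x: "x \<in> U"
  shows "jet sc f [] (x, ys) (sc s z) = s * jet sc f [] (x, ys) z"
proof -
  have D: "((\<lambda>t. (f (x + sc t w) - f x) / t) \<longlongrightarrow> jet sc f [] (x, ys) w) (at 0)" for w
  proof -
    have "jet sc f [] (x, ys) w = iter_dd sc f (Suc 0) x (\<lambda>_. w)"
      by (simp add: fderiv1_eq_jet[symmetric] fderiv1_def)
    then show ?thesis
      using smooth_on_derivative[OF f x, of 0 "\<lambda>_. w"] by (simp add: iter_dd.simps(1))
  qed
  show ?thesis
  proof (cases "s = 0")
    case True
    have "((\<lambda>t. 0) \<longlongrightarrow> jet sc f [] (x, ys) 0) (at (0::'k))" using D[of 0] by simp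
    then show ?thesis using True by (simp add: tendsto_const_iff)
  next
    case False
    \<comment> \<open>Substitute \<open>t * s\<close> for \<open>t\<close> in the difference
      quotient. This avoids 0 only for nonzero \<open>s\<close>, hence the case distinction.\<close>
    have "filterlim (\<lambda>t. t * s) (at 0) (at (0::'k))"
      using False by (auto simp: filterlim_at eventually_at intro!: tendsto_eq_intros exI[of _ 1])
    from tendsto_mult[OF tendsto_const[of s] filterlim_compose[OF D this]]
    have "((\<lambda>t. s * ((f (x + sc (t * s) z) - f x) / (t * s))) \<longlongrightarrow> s * jet sc f [] (x, ys) z) (at 0)"
      by simp
    moreover have "s * (a / (t * s)) = a / t" for a t
      using False by (simp add: divide_simps)
    ultimately have "((\<lambda>t. (f (x + sc t (sc s z)) - f x) / t) \<longlongrightarrow> s * jet sc f [] (x, ys) z) (at 0)"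
      by simp
    then show ?thesis using tendsto_unique[OF _ D] by auto
  qed
qed

text \<open>Linearity passes to pointwise limits of difference quotients. The base point is
  generalised because the induction hypothesis is also used at the nearby points
  \<open>x + sc t (ys k)\<close>.\<close>

lemma jet_linear:
  assumes f: "smooth_on sc T U f" and "x \<in> U"
  shows "jet sc f I (x, ys) (y + z) = jet sc f I (x, ys) y + jet sc f I (x, ys) z \<and>
    jet sc f I (x, ys) (sc s z) = s * jet sc f I (x, ys) z"
  using \<open>x \<in> U\<close>
proof (induction I arbitrary: x rule: rev_induct)
  case Nil
  then show ?case using jet_Nil_add[OF f] jet_Nil_scale[OF f] by blast
next
  case (snoc k I)
  let ?q = "\<lambda>z t. (jet sc f I (x + sc t (ys k), ys) z - jet sc f I (x, ys) z) / t"
  note D = jet_derivative[OF f snoc.prems]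
  have "\<forall>\<^sub>F t in at 0. ?q (y + z) t = ?q y t + ?q z t"
    using eventually_line_in_U[OF snoc.prems, of "ys k"]
    by (rule eventually_mono) (simp add: snoc.IH snoc.prems diff_divide_distrib add_divide_distrib)
  then have 1: "(?q (y + z) \<longlongrightarrow> jet sc f (I @ [k]) (x, ys) y + jet sc f (I @ [k]) (x, ys) z) (at 0)"
    by (rule tendsto_cong[THEN iffD2]) (intro tendsto_add D)
  have "\<forall>\<^sub>F t in at 0. ?q (sc s z) t = s * ?q z t"
    using eventually_line_in_U[OF snoc.prems, of "ys k"]
    by (rule eventually_mono) (simp add: snoc.IH snoc.prems algebra_simps)
  then have 2: "(?q (sc s z) \<longlongrightarrow> s * jet sc f (I @ [k]) (x, ys) z) (at 0)"
    by (rule tendsto_cong[THEN iffD2]) (intro tendsto_mult_left D)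
  show ?case
    using tendsto_unique[OF _ D 1] tendsto_unique[OF _ D 2] by simp
qed

lemma jet_in_dual:
  assumes f: "smooth_on sc T U f" and x: "fst p \<in> U"
  shows "jet sc f I p \<in> dual sc T"
proof -
  have "continuous_map T euclidean (jet sc f I p)"
    unfolding continuous_map_iff_limitin
  proof
    fix z
    have Y: "limitin T (\<lambda>z. case_nat z (\<lambda>m. snd p (I ! m)) i)
        (case_nat z (\<lambda>m. snd p (I ! m)) i) (nhdsin T z)" for i
      by (cases i) (auto simp: limitin_id_nhdsin)
    have "(jet sc f I p \<longlongrightarrow> jet sc f I p z) (nhdsin T z)"
      unfolding jet_def by (rule tendsto_iter_dd[OF f _ x Y]) auto
    then show "limitin euclidean (jet sc f I p) (jet sc f I p z) (nhdsin T z)" by simp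
  qed
  then show ?thesis
    using jet_linear[OF f x, of _ "snd p"] by (simp add: dual_def)
qed

lemma limitin_dual_c:
  "limitin (dual_c sc T) f l F \<longleftrightarrow> l \<in> dual sc T \<and> (\<forall>\<^sub>F i in F. f i \<in> dual sc T) \<and>
     (\<forall>C e. compactin T C \<longrightarrow> e > 0 \<longrightarrow> (\<forall>\<^sub>F i in F. \<forall>x\<in>C. norm (f i x - l x) < e))"
  unfolding dual_c_def by (rule limitin_ucc_topology) (simp add: dual_def)

lemma topspace_dual_c [simp]: "topspace (dual_c sc T) = dual sc T"
  unfolding dual_c_def ucc_topology_def topology_generated_by_topspace by blast

text \<open>Joint continuity of the derivative in base point, free direction and remaining
  directions becomes, by the tube lemma over a compact set of free directions, uniform closeness of
  the jets. This is the elementary half of the exponential law.\<close>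

lemma limitin_jet:
  assumes f: "smooth_on sc T U f" and p: "limitin (dk_domain T U k) p q F" and I: "set I \<subseteq> {..<k}"
  shows "limitin (dual_c sc T) (\<lambda>i. jet sc f I (p i)) (jet sc f I q) F"
  unfolding limitin_dual_c
proof (intro conjI allI impI)
  have q: "fst q \<in> U"
    using limitin_topspace[OF p] topspace_dk_domain by auto
  then show "jet sc f I q \<in> dual sc T" by (rule jet_in_dual[OF f])
  show "\<forall>\<^sub>F i in F. jet sc f I (p i) \<in> dual sc T"
    using eventually_in_U[OF limitin_dk_domain_fst[OF p] q] by (rule eventually_mono) (rule jet_in_dual[OF f])
  fix C :: "'e set" and e :: real
  assume C: "compactin T C" and e: "e > 0"
  show "\<forall>\<^sub>F i in F. \<forall>x\<in>C. norm (jet sc f I (p i) x - jet sc f I q x) < e"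
  proof (rule eventually_compactin[OF C])
    fix z assume z: "z \<in> C"
    let ?F = "F \<times>\<^sub>F nhdsin (subtopology T C) z"
    have z_lim: "limitin T (\<lambda>a. snd a) z ?F"
      by (rule limitin_prod_filter2[OF limitin_id_nhdsin_subtopology]) (use z in auto)
    have nth: "I ! m < k" if "m < length I" for m using I that nth_mem by blast
    have "((\<lambda>a. jet sc f I (p (fst a)) (snd a)) \<longlongrightarrow> jet sc f I q z) ?F"
      unfolding jet_def
    proof (rule tendsto_iter_dd[OF f _ q])
      show "limitin T (\<lambda>a. fst (p (fst a))) (fst q) ?F"
        by (rule limitin_prod_filter1[OF limitin_dk_domain_fst[OF p]])
      show "limitin T (\<lambda>a. case_nat (snd a) (\<lambda>m. snd (p (fst a)) (I ! m)) i)
          (case_nat z (\<lambda>m. snd q (I ! m)) i) ?F" if "i < Suc (length I)" for i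
        using that z_lim limitin_prod_filter1[OF limitin_dk_domain_snd[OF p nth]]
        by (cases i) auto
    qed
    moreover have "((\<lambda>a. jet sc f I q (snd a)) \<longlongrightarrow> jet sc f I q z) ?F"
    proof -
      have "continuous_map T euclidean (jet sc f I q)"
        using jet_in_dual[OF f q] by (simp add: dual_def)
      from continuous_map_limitin[OF this z_lim] show ?thesis by simp
    qed
    ultimately have "((\<lambda>a. jet sc f I (p (fst a)) (snd a) - jet sc f I q (snd a))
        \<longlongrightarrow> jet sc f I q z - jet sc f I q z) ?F"
      by (rule tendsto_diff)
    from tendstoD[OF this e]
    show "\<forall>\<^sub>F a in ?F. norm (jet sc f I (p (fst a)) (snd a) - jet sc f I q (snd a)) < e"
      by simp
  qed
qed

lemma limitin_jet_difference_quotient: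
  assumes f: "smooth_on sc T U f" and x: "x \<in> U"
  shows "limitin (dual_c sc T)
    (\<lambda>t z. (jet sc f I (x + sc t (ys k), ys) z - jet sc f I (x, ys) z) / t) (jet sc f (I @ [k]) (x, ys)) (at 0)"
  unfolding limitin_dual_c
proof (intro conjI allI impI)
  show "jet sc f (I @ [k]) (x, ys) \<in> dual sc T" by (rule jet_in_dual[OF f]) (simp add: x)
  show "\<forall>\<^sub>F t in at 0. (\<lambda>z. (jet sc f I (x + sc t (ys k), ys) z - jet sc f I (x, ys) z) / t) \<in> dual sc T"
    using eventually_line_in_U[OF x, of "ys k"]
  proof (rule eventually_mono)
    fix t assume "x + sc t (ys k) \<in> U"
    then have "jet sc f I (x + sc t (ys k), ys) \<in> dual sc T" "jet sc f I (x, ys) \<in> dual sc T"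
      using x by (auto intro: jet_in_dual[OF f])
    then show "(\<lambda>z. (jet sc f I (x + sc t (ys k), ys) z - jet sc f I (x, ys) z) / t) \<in> dual sc T"
      by (rule dual_diff_divide)
  qed
qed (use jet_derivative_uniform[OF f x] in blast)

end

section \<open>The topology of smooth functions\<close>

context open_in_lcs
begin

lemma Cinf_smooth_on: "f \<in> Cinf sc T U \<Longrightarrow> smooth_on sc T U f"
  by (simp add: Cinf_def)

lemma topspace_Cinf_topology [simp]: "topspace (Cinf_topology sc T U) = Cinf sc T U"
  unfolding Cinf_topology_def topology_generated_by_topspace by blast

lemma continuous_map_iter_dd:
  "f \<in> Cinf sc T U \<Longrightarrow> continuous_map (dk_domain T U k) euclidean (\<lambda>p. iter_dd sc f k (fst p) (snd p))"
  using Cinf_smooth_on unfolding smooth_on_def by (simp add: case_prod_unfold)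

text \<open>To recover a uniform neighbourhood of \<open>l\<close> from the compact-open subbasis, \<open>K\<close> is cut into
finitely many compact pieces on which \<open>d^k l\<close> is nearly constant.\<close>

lemma limitin_Cinf_topology:
  "limitin (Cinf_topology sc T U) f l F \<longleftrightarrow> l \<in> Cinf sc T U \<and> (\<forall>\<^sub>F i in F. f i \<in> Cinf sc T U) \<and>
     (\<forall>k K e. compactin (dk_domain T U k) K \<longrightarrow> e > 0 \<longrightarrow>
        (\<forall>\<^sub>F i in F. \<forall>p\<in>K. norm (iter_dd sc (f i) k (fst p) (snd p) - iter_dd sc l k (fst p) (snd p)) < e))"
    (is "?L \<longleftrightarrow> ?R")
proof
  assume L: ?L
  note L' = L[unfolded Cinf_topology_def limitin_topology_generated_by case_prod_unfold]
  have l: "l \<in> Cinf sc T U" using L' by blast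
  moreover have "\<forall>\<^sub>F i in F. f i \<in> Cinf sc T U" using L' l by blast
  moreover have "\<forall>\<^sub>F i in F. \<forall>p\<in>K. norm (iter_dd sc (f i) k (fst p) (snd p) - iter_dd sc l k (fst p) (snd p)) < e"
    if K: "compactin (dk_domain T U k) K" and e: "e > 0" for k K e
  proof -
    let ?h = "\<lambda>g p. iter_dd sc g k (fst p) (snd p)"
    note cont = continuous_map_iter_dd[OF l, of k]
    have "compact (?h l ` K)" using image_compactin[OF K cont] by simp
    then obtain C where C: "C \<subseteq> ?h l ` K" "finite C" "?h l ` K \<subseteq> (\<Union>c\<in>C. ball c (e / 3))"
    proof (rule compactE_image[of "?h l ` K" "?h l ` K" "\<lambda>c. ball c (e / 3)"])
      show "?h l ` K \<subseteq> (\<Union>c\<in>?h l ` K. ball c (e / 3))" using e by force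
    qed auto
    \<comment> \<open>Closed balls make the pieces closed in \<open>K\<close>, hence compact. The
      open ball of the larger radius \<open>e / 2\<close> contains the image of \<open>P c\<close>
      under the derivative of \<open>l\<close>, and \<open>e / 2 + e / 3 < e\<close>.\<close>
    define P where "P c = K \<inter> {p \<in> topspace (dk_domain T U k). ?h l p \<in> cball c (e / 3)}" for c
    have P: "compactin (dk_domain T U k) (P c)" for c
      unfolding P_def
      by (intro compact_Int_closedin K closedin_continuous_map_preimage[OF cont]) simp
    have ev: "\<forall>\<^sub>F i in F. f i \<in> {g \<in> Cinf sc T U. ?h g ` P c \<subseteq> ball c (e / 2)}" for c
    proof (rule L'[THEN conjunct2, rule_format])
      show "l \<in> {g \<in> Cinf sc T U. ?h g ` P c \<subseteq> ball c (e / 2)}"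
        using l e by (auto simp: P_def)
      show "{g \<in> Cinf sc T U. ?h g ` P c \<subseteq> ball c (e / 2)} \<in> {Cinf sc T U} \<union>
          {{g \<in> Cinf sc T U. (\<lambda>p. iter_dd sc g k (fst p) (snd p)) ` K \<subseteq> W} | k K W.
            compactin (dk_domain T U k) K \<and> open W}"
        using P open_ball by blast
    qed
    have "\<forall>\<^sub>F i in F. ?h (f i) ` P c \<subseteq> ball c (e / 2)" for c
      using ev[of c] by (rule eventually_mono) simp
    then have "\<forall>\<^sub>F i in F. \<forall>c\<in>C. ?h (f i) ` P c \<subseteq> ball c (e / 2)"
      using C by (intro eventually_ball_finite) auto
    then show ?thesis
    proof (rule eventually_mono, intro ballI)
      fix i p assume i: "\<forall>c\<in>C. ?h (f i) ` P c \<subseteq> ball c (e / 2)" and p: "p \<in> K"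
      obtain c where c: "c \<in> C" "?h l p \<in> ball c (e / 3)" using C(3) p by blast
      then have "p \<in> P c" using p compactin_subset_topspace[OF K] by (auto simp: P_def)
      then have "?h (f i) p \<in> ball c (e / 2)" using i c by blast
      then have "dist (?h (f i) p) c < e / 2" "dist (?h l p) c < e / 3"
        using c by (simp_all add: dist_commute)
      then have "dist (?h (f i) p) (?h l p) < e"
        using dist_triangle2[of "?h (f i) p" "?h l p" c] e by linarith
      then show "norm (?h (f i) p - ?h l p) < e" by (simp add: dist_norm)
    qed
  qed
  ultimately show ?R by blast
next
  assume R: ?R
  then have l: "l \<in> Cinf sc T U" by blast
  have main: "\<forall>\<^sub>F i in F. f i \<in> {g \<in> Cinf sc T U. (\<lambda>(x, ys). iter_dd sc g k x ys) ` K \<subseteq> W}"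
    if K: "compactin (dk_domain T U k) K" and W: "open W"
      and lW: "(\<lambda>(x, ys). iter_dd sc l k x ys) ` K \<subseteq> W" for k K W
  proof -
    have "compact ((\<lambda>p. iter_dd sc l k (fst p) (snd p)) ` K)"
      using image_compactin[OF K continuous_map_iter_dd[OF l, of k]] by simp
    then obtain e where e: "e > 0" "(\<Union>y\<in>(\<lambda>p. iter_dd sc l k (fst p) (snd p)) ` K. ball y e) \<subseteq> W"
      using compact_subset_open_imp_ball_epsilon_subset W lW[unfolded case_prod_unfold] by metis
    have "\<forall>\<^sub>F i in F. f i \<in> Cinf sc T U \<and>
        (\<forall>p\<in>K. norm (iter_dd sc (f i) k (fst p) (snd p) - iter_dd sc l k (fst p) (snd p)) < e)"
      using R K e by (auto intro: eventually_conj)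
    then show ?thesis
    proof (rule eventually_mono)
      fix i assume i: "f i \<in> Cinf sc T U \<and>
        (\<forall>p\<in>K. norm (iter_dd sc (f i) k (fst p) (snd p) - iter_dd sc l k (fst p) (snd p)) < e)"
      have "iter_dd sc (f i) k (fst p) (snd p) \<in> W" if "p \<in> K" for p
        using i that e(2) by (force simp: dist_norm norm_minus_commute)
      then show "f i \<in> {g \<in> Cinf sc T U. (\<lambda>(x, ys). iter_dd sc g k x ys) ` K \<subseteq> W}"
        using i by auto
    qed
  qed
  show ?L
    unfolding Cinf_topology_def limitin_topology_generated_by
    using R l main by auto
qed

text \<open>The topology on functions controls derivatives only on compact sets, so
  \<open>p i\<close> has to stay in \<open>K\<close>. The error splits into replacing
  \<open>f i\<close> by \<open>f0\<close> at \<open>p i\<close>, which is small uniformly over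
  \<open>K \<times> C\<close>, and moving from \<open>p i\<close> to \<open>q\<close> for the fixed
  \<open>f0\<close>.\<close>

lemma limitin_jet_Cinf:
  assumes f: "limitin (Cinf_topology sc T U) f f0 F" and p: "limitin (dk_domain T U k) p q F"
    and K: "compactin (dk_domain T U k) K" "\<forall>\<^sub>F i in F. p i \<in> K" and I: "set I \<subseteq> {..<k}"
  shows "limitin (dual_c sc T) (\<lambda>i. jet sc (f i) I (p i)) (jet sc f0 I q) F"
  unfolding limitin_dual_c
proof (intro conjI allI impI)
  have f0: "f0 \<in> Cinf sc T U" and evf: "\<forall>\<^sub>F i in F. f i \<in> Cinf sc T U"
    using f unfolding limitin_Cinf_topology by blast+
  note lim0 = limitin_jet[OF Cinf_smooth_on[OF f0] p I, unfolded limitin_dual_c]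
  have q: "fst q \<in> U" using limitin_topspace[OF p] topspace_dk_domain by auto
  show "jet sc f0 I q \<in> dual sc T" using lim0 by blast
  show "\<forall>\<^sub>F i in F. jet sc (f i) I (p i) \<in> dual sc T"
    using eventually_conj[OF evf eventually_in_U[OF limitin_dk_domain_fst[OF p] q]]
    by (rule eventually_mono) (blast intro: jet_in_dual Cinf_smooth_on)
  fix C :: "'e set" and e :: real
  assume C: "compactin T C" and e: "e > 0"
  \<comment> \<open>\<open>\<iota>\<close> sends \<open>((x, y), z)\<close> to the argument
    \<open>(x, z, y_I)\<close> of the derivative of order \<open>length I + 1\<close> that the jet
    evaluates; its continuity makes the set of arguments arising from \<open>K \<times> C\<close>
    compact.\<close>
  define \<iota> where "\<iota> = (\<lambda>(p, z). (fst p :: 'e, restrict (case_nat (z :: 'e) (\<lambda>m. snd p (I ! m))) {..<Suc (length I)}))"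
  have \<iota>: "continuous_map (prod_topology (dk_domain T U k) T) (dk_domain T U (Suc (length I))) \<iota>"
    unfolding continuous_map_iff_limitin
  proof
    let ?X = "prod_topology (dk_domain T U k) T"
    fix r assume r: "r \<in> topspace ?X"
    have 1: "limitin (dk_domain T U k) fst (fst r) (nhdsin ?X r)"
      and 2: "limitin T snd (snd r) (nhdsin ?X r)"
      using limitin_id_nhdsin[OF r] by (simp_all add: limitin_pairwise o_def)
    have nth: "I ! m < k" if "m < length I" for m using I that nth_mem by blast
    have "fst (fst r) \<in> U" using r topspace_dk_domain by auto
    moreover have "limitin T (\<lambda>a. case_nat (snd a) (\<lambda>m. snd (fst a) (I ! m)) i)
        (case_nat (snd r) (\<lambda>m. snd (fst r) (I ! m)) i) (nhdsin ?X r)" if "i < Suc (length I)" for i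
      using that 2 limitin_dk_domain_snd[OF 1 nth] by (cases i) auto
    ultimately show "limitin (dk_domain T U (Suc (length I))) \<iota> (\<iota> r) (nhdsin ?X r)"
      unfolding \<iota>_def case_prod_unfold
      by (intro limitin_dk_domain[OF limitin_dk_domain_fst[OF 1]])
  qed
  have jet: "jet sc g I p z = iter_dd sc g (Suc (length I)) (fst (\<iota> (p, z))) (snd (\<iota> (p, z)))" for g p z
    unfolding jet_def \<iota>_def by (simp, rule iter_dd_cong) simp
  have "compactin (dk_domain T U (Suc (length I))) (\<iota> ` (K \<times> C))"
    by (rule image_compactin[OF _ \<iota>]) (simp add: compactin_Times K C)
  then have 1: "\<forall>\<^sub>F i in F. \<forall>r\<in>\<iota> ` (K \<times> C). norm (iter_dd sc (f i) (Suc (length I)) (fst r) (snd r)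
      - iter_dd sc f0 (Suc (length I)) (fst r) (snd r)) < e / 2"
    using f e unfolding limitin_Cinf_topology by (meson half_gt_zero)
  have 2: "\<forall>\<^sub>F i in F. \<forall>z\<in>C. norm (jet sc f0 I (p i) z - jet sc f0 I q z) < e / 2"
    using lim0 C e by (meson half_gt_zero)
  show "\<forall>\<^sub>F i in F. \<forall>z\<in>C. norm (jet sc (f i) I (p i) z - jet sc f0 I q z) < e"
    using K(2) 1 2
  proof eventually_elim
    case (elim i)
    show ?case
    proof
      fix z assume z: "z \<in> C"
      have "norm (jet sc (f i) I (p i) z - jet sc f0 I (p i) z) < e / 2"
        unfolding jet using elim z by auto
      then show "norm (jet sc (f i) I (p i) z - jet sc f0 I q z) < e"
        using elim z norm_diff_triangle_less by (metis field_sum_of_halves)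
    qed
  qed
qed

text \<open>The set \<open>N\<close> is the image of \<open>M \<times> K\<close> under a map that is
  continuous for the relative topologies. Such sets are the ones fed to the hypocontinuity of the
  bracket on the dual when a function stays in \<open>M\<close> and the point in
  \<open>K\<close>.\<close>

lemma compactin_jets:
  assumes M: "compactin (Cinf_topology sc T U) M" and K: "compactin (dk_domain T U k) K"
    and I: "set I \<subseteq> {..<k}"
  shows "\<exists>N. compactin (dual_c sc T) N \<and> (\<forall>g\<in>M. \<forall>p\<in>K. jet sc g I p \<in> N)"
proof -
  let ?X = "prod_topology (subtopology (Cinf_topology sc T U) M) (subtopology (dk_domain T U k) K)"
  have "continuous_map ?X (dual_c sc T) (\<lambda>r. jet sc (fst r) I (snd r))"
    unfolding continuous_map_iff_limitin
  proof
    fix r assume r: "r \<in> topspace ?X"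
    have 1: "limitin (Cinf_topology sc T U) fst (fst r) (nhdsin ?X r)"
      and 2: "limitin (dk_domain T U k) snd (snd r) (nhdsin ?X r)"
      and 3: "\<forall>\<^sub>F a in nhdsin ?X r. snd a \<in> K"
      using limitin_id_nhdsin[OF r] by (simp_all add: limitin_pairwise o_def limitin_subtopology)
    show "limitin (dual_c sc T) (\<lambda>r. jet sc (fst r) I (snd r)) (jet sc (fst r) I (snd r)) (nhdsin ?X r)"
      by (rule limitin_jet_Cinf[OF 1 2 K 3 I])
  qed
  moreover have "compactin ?X (M \<times> K)"
    using M K by (simp add: compactin_Times compactin_subtopology)
  ultimately have "compactin (dual_c sc T) ((\<lambda>r. jet sc (fst r) I (snd r)) ` (M \<times> K))"
    by (rule image_compactin[rotated])
  then show ?thesis by (intro exI[of _ "(\<lambda>r. jet sc (fst r) I (snd r)) ` (M \<times> K)"]) force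
qed

end

section \<open>The bracket on the dual\<close>

locale open_in_poisson_space = open_in_lcs sc T U
  for sc :: "'k::real_normed_field \<Rightarrow> 'e::ab_group_add \<Rightarrow> 'e" and T U +
  fixes br :: "('e \<Rightarrow> 'k) \<Rightarrow> ('e \<Rightarrow> 'k) \<Rightarrow> 'e \<Rightarrow> 'k"
  assumes poisson: "lc_poisson_space sc T br"
begin

abbreviation "E' \<equiv> dual sc T"
abbreviation "E'\<^sub>c \<equiv> dual_c sc T"

lemma poisson_axioms:
  shows br_in_dual_ball: "\<forall>a\<in>E'. \<forall>b\<in>E'. br a b \<in> E'"
    and br_add_ball: "\<forall>a\<in>E'. \<forall>b\<in>E'. \<forall>c\<in>E'.
         br (\<lambda>x. a x + b x) c = (\<lambda>x. br a c x + br b c x) \<and>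
         br c (\<lambda>x. a x + b x) = (\<lambda>x. br c a x + br c b x)"
    and br_scale_ball: "\<forall>s. \<forall>a\<in>E'. \<forall>b\<in>E'.
         br (\<lambda>x. s * a x) b = (\<lambda>x. s * br a b x) \<and>
         br a (\<lambda>x. s * b x) = (\<lambda>x. s * br a b x)"
    and br_self_ball: "\<forall>a\<in>E'. br a a = (\<lambda>x. 0)"
    and br_hypo: "hypocontinuous2 E'\<^sub>c E'\<^sub>c E'\<^sub>c br (\<lambda>x. 0) (\<lambda>x. 0)"
  using poisson unfolding lc_poisson_space_def by - ((elim conjE, assumption)+)

lemmas br_in_dual = br_in_dual_ball[rule_format]
lemmas br_add_left = br_add_ball[rule_format, THEN conjunct1]
lemmas br_add_right = br_add_ball[rule_format, THEN conjunct2]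
lemmas br_scale_left = br_scale_ball[rule_format, THEN conjunct1]
lemmas br_self = br_self_ball[rule_format]

lemma br_antisym:
  assumes a: "a \<in> E'" and b: "b \<in> E'"
  shows "br a b = (\<lambda>x. - br b a x)"
proof -
  have ab: "(\<lambda>x. a x + b x) \<in> E'" by (rule dual_add[OF a b])
  have "br (\<lambda>x. a x + b x) (\<lambda>x. a x + b x) = (\<lambda>x. (br a a x + br a b x) + (br b a x + br b b x))"
    using br_add_left[OF a b ab] br_add_right[OF a b a] br_add_right[OF a b b] by simp
  then have "(\<lambda>x. br a b x + br b a x) = (\<lambda>x. 0)"
    using br_self[OF ab] br_self[OF a] br_self[OF b] by simp
  then show ?thesis by (metis add.commute add_eq_0_iff)
qed

lemma br_diff_divide_left:
  assumes a: "a \<in> E'" and b: "b \<in> E'" and c: "c \<in> E'"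
  shows "br (\<lambda>x. (a x - b x) / t) c = (\<lambda>x. (br a c x - br b c x) / t)"
proof -
  note b' = dual_scale[OF b, of "-1"]
  have "(\<lambda>x. (a x - b x) / t) = (\<lambda>x. inverse t * (a x + (-1) * b x))" by (simp add: field_simps)
  then have "br (\<lambda>x. (a x - b x) / t) c = (\<lambda>x. inverse t * (br a c x + (-1) * br b c x))"
    using br_scale_left[OF dual_add[OF a b'] c] br_add_left[OF a b' c] br_scale_left[OF b c, of "-1"]
    by simp
  then show ?thesis by (simp add: field_simps)
qed

lemma br_diff_divide_right:
  assumes a: "a \<in> E'" and b: "b \<in> E'" and c: "c \<in> E'"
  shows "br c (\<lambda>x. (a x - b x) / t) = (\<lambda>x. (br c a x - br c b x) / t)"
  using br_antisym[OF c dual_diff_divide[OF a b]] br_diff_divide_left[OF a b c]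
    br_antisym[OF c a] br_antisym[OF c b]
  by (simp add: fun_eq_iff diff_divide_distrib)

lemma limitin_dual_c_add:
  assumes "limitin E'\<^sub>c a a0 F" "limitin E'\<^sub>c b b0 F"
  shows "limitin E'\<^sub>c (\<lambda>i x. a i x + b i x) (\<lambda>x. a0 x + b0 x) F"
  unfolding limitin_dual_c
proof (intro conjI allI impI)
  show "(\<lambda>x. a0 x + b0 x) \<in> E'" using assms dual_add limitin_dual_c by blast
  have "\<forall>\<^sub>F i in F. a i \<in> E' \<and> b i \<in> E'" using assms limitin_dual_c eventually_conj by blast
  then show "\<forall>\<^sub>F i in F. (\<lambda>x. a i x + b i x) \<in> E'" by (rule eventually_mono) (blast intro: dual_add)
  fix C :: "'e set" and e :: real
  assume "compactin T C" "e > 0"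
  then have "\<forall>\<^sub>F i in F. \<forall>x\<in>C. norm (a i x - a0 x) < e / 2" "\<forall>\<^sub>F i in F. \<forall>x\<in>C. norm (b i x - b0 x) < e / 2"
    using assms unfolding limitin_dual_c by (meson half_gt_zero)+
  then show "\<forall>\<^sub>F i in F. \<forall>x\<in>C. norm (a i x + b i x - (a0 x + b0 x)) < e"
  proof eventually_elim
    case (elim i)
    show ?case
    proof
      fix x assume "x \<in> C"
      then show "norm (a i x + b i x - (a0 x + b0 x)) < e"
        using elim norm_diff_triangle_ineq[of "a i x" "b i x" "a0 x" "b0 x"] by fastforce
    qed
  qed
qed

lemma limitin_dual_c_scale:
  assumes "limitin E'\<^sub>c a a0 F"
  shows "limitin E'\<^sub>c (\<lambda>i x. s * a i x) (\<lambda>x. s * a0 x) F"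
  unfolding limitin_dual_c
proof (intro conjI allI impI)
  show "(\<lambda>x. s * a0 x) \<in> E'" using assms dual_scale limitin_dual_c by blast
  have "\<forall>\<^sub>F i in F. a i \<in> E'" using assms limitin_dual_c by blast
  then show "\<forall>\<^sub>F i in F. (\<lambda>x. s * a i x) \<in> E'" by (rule eventually_mono) (blast intro: dual_scale)
  fix C :: "'e set" and e :: real
  assume C: "compactin T C" and e: "e > 0"
  have pos: "norm s + 1 > 0" by (simp add: add_nonneg_pos)
  then have "\<forall>\<^sub>F i in F. \<forall>x\<in>C. norm (a i x - a0 x) < e / (norm s + 1)"
    using assms C e unfolding limitin_dual_c by simp
  then show "\<forall>\<^sub>F i in F. \<forall>x\<in>C. norm (s * a i x - s * a0 x) < e"
  proof (rule eventually_mono, intro ballI)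
    fix i x assume "\<forall>x\<in>C. norm (a i x - a0 x) < e / (norm s + 1)" "x \<in> C"
    then have "norm (a i x - a0 x) * (norm s + 1) < e" using pos by (simp add: pos_less_divide_eq)
    then have "norm s * norm (a i x - a0 x) + norm (a i x - a0 x) < e" by (simp add: algebra_simps)
    then have "norm s * norm (a i x - a0 x) < e" using norm_ge_zero[of "a i x - a0 x"] by linarith
    then show "norm (s * a i x - s * a0 x) < e" by (simp add: norm_mult flip: right_diff_distrib)
  qed
qed

lemma zero_in_dual: "(\<lambda>x. 0) \<in> E'"
  by (simp add: dual_def)

text \<open>Write \<open>br (a i) (b i)\<close> as the sum of \<open>br (a i - a0) (b i)\<close> and
  \<open>br a0 (b i)\<close>. In the first summand the left argument tends to 0 while the right one
  stays in \<open>M\<close>, so hypocontinuity applies; the other summand needs only separate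
  continuity.\<close>

lemma limitin_br_hypo:
  assumes a: "limitin E'\<^sub>c a a0 F" and b: "limitin E'\<^sub>c b b0 F"
    and M: "compactin E'\<^sub>c M" "\<forall>\<^sub>F i in F. b i \<in> M"
  shows "limitin E'\<^sub>c (\<lambda>i. br (a i) (b i)) (br a0 b0) F"
proof -
  have a0: "a0 \<in> E'" and b0: "b0 \<in> E'" and ev: "\<forall>\<^sub>F i in F. a i \<in> E' \<and> b i \<in> E'"
    using a b unfolding limitin_dual_c by (auto intro: eventually_conj)
  have "limitin E'\<^sub>c (\<lambda>i x. a i x + (-1) * a0 x) (\<lambda>x. a0 x + (-1) * a0 x) F"
    by (rule limitin_dual_c_add[OF a]) (use dual_scale[OF a0, of "-1"] in simp)
  then have diff: "limitin E'\<^sub>c (\<lambda>i x. a i x - a0 x) (\<lambda>x. 0) F" by simp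
  have "limitin E'\<^sub>c (\<lambda>i. br (\<lambda>x. a i x - a0 x) (b i)) (\<lambda>x. 0) F"
    unfolding limitin_def
  proof (intro conjI allI impI)
    show "(\<lambda>x. 0) \<in> topspace E'\<^sub>c" using zero_in_dual by simp
    fix G assume G: "openin E'\<^sub>c G \<and> (\<lambda>x. 0) \<in> G"
    then have "nbhd E'\<^sub>c (\<lambda>x. 0) G" unfolding nbhd_def using openin_subset by blast
    then obtain V where V: "nbhd E'\<^sub>c (\<lambda>x. 0) V" "\<forall>v\<in>V. \<forall>m\<in>M. br v m \<in> G"
      using br_hypo M(1) unfolding hypocontinuous2_def by blast
    then obtain V' where V': "openin E'\<^sub>c V'" "(\<lambda>x. 0) \<in> V'" "V' \<subseteq> V"
      unfolding nbhd_def by blast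
    show "\<forall>\<^sub>F i in F. br (\<lambda>x. a i x - a0 x) (b i) \<in> G"
      using limitinD[OF diff V'(1,2)] M(2) by eventually_elim (use V V' in blast)
  qed
  moreover have "limitin E'\<^sub>c (\<lambda>i. br a0 (b i)) (br a0 b0) F"
  proof -
    have "continuous_map E'\<^sub>c E'\<^sub>c (br a0)"
      using br_hypo a0 unfolding hypocontinuous2_def by simp
    from continuous_map_limitin[OF this b] show ?thesis .
  qed
  ultimately have sum: "limitin E'\<^sub>c (\<lambda>i x. br (\<lambda>x. a i x - a0 x) (b i) x + br a0 (b i) x)
      (\<lambda>x. 0 + br a0 b0 x) F"
    by (rule limitin_dual_c_add)
  have "\<forall>\<^sub>F i in F. (\<lambda>x. br (\<lambda>x. a i x - a0 x) (b i) x + br a0 (b i) x) = br (a i) (b i)"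
    using ev
  proof (rule eventually_mono)
    fix i assume "a i \<in> E' \<and> b i \<in> E'"
    then show "(\<lambda>x. br (\<lambda>x. a i x - a0 x) (b i) x + br a0 (b i) x) = br (a i) (b i)"
      using br_diff_divide_left[of "a i" a0 "b i" 1] a0 by simp
  qed
  from limitin_transform_eventually[OF this sum] show ?thesis by simp
qed

text \<open>Three sufficient conditions are kept as one disjunction, which the later limit theorems
  repeat for functions. A compact set for the second argument leads to hypocontinuity, one for the
  first argument (by antisymmetry) to separate continuity in the second variable, and the last
  alternative to the continuous case.\<close>

lemma limitin_br:
  assumes a: "limitin E'\<^sub>c a a0 F" and b: "limitin E'\<^sub>c b b0 F"
    and M: "(\<exists>M. compactin E'\<^sub>c M \<and> (\<forall>\<^sub>F i in F. b i \<in> M)) \<or>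
      (\<exists>M. compactin E'\<^sub>c M \<and> (\<forall>\<^sub>F i in F. a i \<in> M)) \<or>
      continuous_map (prod_topology E'\<^sub>c E'\<^sub>c) E'\<^sub>c (\<lambda>(a, b). br a b)"
  shows "limitin E'\<^sub>c (\<lambda>i. br (a i) (b i)) (br a0 b0) F"
  using M
proof (elim disjE exE conjE)
  fix M assume "compactin E'\<^sub>c M" "\<forall>\<^sub>F i in F. b i \<in> M"
  then show ?thesis by (rule limitin_br_hypo[OF a b])
next
  fix M assume "compactin E'\<^sub>c M" "\<forall>\<^sub>F i in F. a i \<in> M"
  then have "limitin E'\<^sub>c (\<lambda>i. br (b i) (a i)) (br b0 a0) F" by (rule limitin_br_hypo[OF b a])
  from limitin_dual_c_scale[OF this, of "-1"]
  have lim: "limitin E'\<^sub>c (\<lambda>i x. - br (b i) (a i) x) (\<lambda>x. - br b0 a0 x) F" by simp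
  have "\<forall>\<^sub>F i in F. a i \<in> E' \<and> b i \<in> E'" and 0: "a0 \<in> E'" "b0 \<in> E'"
    using a b unfolding limitin_dual_c by (auto intro: eventually_conj)
  from this(1) have "\<forall>\<^sub>F i in F. (\<lambda>x. - br (b i) (a i) x) = br (a i) (b i)"
    by (rule eventually_mono) (use br_antisym in metis)
  from limitin_transform_eventually[OF this lim] show ?thesis by (simp only: br_antisym[OF 0])
next
  assume "continuous_map (prod_topology E'\<^sub>c E'\<^sub>c) E'\<^sub>c (\<lambda>(a, b). br a b)"
  from continuous_map_limitin[OF this limitin_prod_topologyI[OF a b]] show ?thesis by simp
qed

text \<open>Confining \<open>c i\<close> to a compact set lets uniform convergence of
  \<open>l i\<close> on that set replace joint continuity of evaluation; continuity of
  \<open>l0\<close> handles the moving point.\<close>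

lemma tendsto_dual_eval:
  assumes l: "limitin E'\<^sub>c l l0 F" and c: "limitin T c c0 F"
    and C: "compactin T C" "\<forall>\<^sub>F i in F. c i \<in> C"
  shows "((\<lambda>i. l i (c i)) \<longlongrightarrow> l0 c0) F"
proof -
  have "continuous_map T euclidean l0" using l unfolding limitin_dual_c dual_def by blast
  from continuous_map_limitin[OF this c] have 1: "((\<lambda>i. l0 (c i)) \<longlongrightarrow> l0 c0) F" by simp
  have "((\<lambda>i. l i (c i) - l0 (c i)) \<longlongrightarrow> 0) F"
    unfolding tendsto_iff dist_norm
  proof (intro allI impI)
    fix e :: real assume "e > 0"
    then have "\<forall>\<^sub>F i in F. \<forall>x\<in>C. norm (l i x - l0 x) < e" using l C unfolding limitin_dual_c by blast
    with C(2) show "\<forall>\<^sub>F i in F. norm (l i (c i) - l0 (c i) - 0) < e" by eventually_elim simp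
  qed
  from tendsto_add[OF this 1] show ?thesis by simp
qed

end

section \<open>Derivatives of the Poisson bracket\<close>

text \<open>A triple \<open>(I, J, c)\<close> encodes the summand
\<open>[d^{|I|+1} f(x, \<cdot>, ys I), d^{|J|+1} g(x, \<cdot>, ys J)](u)\<close> of \<open>d^k {f,g}(x, ys)\<close>, where the
evaluation point \<open>u\<close> is \<open>x\<close> or, once it has been differentiated in direction \<open>i\<close>, \<open>ys i\<close>.\<close>

type_synonym leibniz_index = "nat list \<times> nat list \<times> nat option"

text \<open>The product rule has three factors: the two functionals and the evaluation point, in
  which the bracket is linear. Once the point is \<open>ys i\<close> it no longer depends on
  \<open>x\<close>, so the second equation has no third summand.\<close>

fun leibniz_step :: "nat \<Rightarrow> leibniz_index \<Rightarrow> leibniz_index list" where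
  "leibniz_step k (I, J, None) = [(I @ [k], J, None), (I, J @ [k], None), (I, J, Some k)]"
| "leibniz_step k (I, J, Some i) = [(I @ [k], J, Some i), (I, J @ [k], Some i)]"

primrec leibniz_indices :: "nat \<Rightarrow> leibniz_index list" where
  "leibniz_indices 0 = [([], [], None)]"
| "leibniz_indices (Suc k) = concat (map (leibniz_step k) (leibniz_indices k))"

lemma leibniz_indices_bounded:
  "(I, J, c) \<in> set (leibniz_indices k) \<Longrightarrow>
    set I \<subseteq> {..<k} \<and> set J \<subseteq> {..<k} \<and> (\<forall>i. c = Some i \<longrightarrow> i < k)"
proof (induction k arbitrary: I J c)
  case (Suc k)
  then obtain \<tau> where "\<tau> \<in> set (leibniz_indices k)" "(I, J, c) \<in> set (leibniz_step k \<tau>)"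
    by auto
  moreover obtain I' J' c' where "\<tau> = (I', J', c')" by (cases \<tau>) blast
  ultimately show ?case
    using Suc.IH[of I' J' c'] by (cases c') (auto simp: less_Suc_eq)
qed simp

lemma sum_list_concat_map:
  "(\<Sum>\<sigma>\<leftarrow>concat (map c xs). G \<sigma>) = (\<Sum>\<tau>\<leftarrow>xs. \<Sum>\<sigma>\<leftarrow>c \<tau>. G \<sigma>)"
  for G :: "'a \<Rightarrow> 'b::comm_monoid_add"
  by (induction xs) simp_all

lemma tendsto_sum_list:
  fixes G :: "'a \<Rightarrow> 'b \<Rightarrow> 'k::real_normed_vector"
  shows "(\<And>\<tau>. \<tau> \<in> set xs \<Longrightarrow> ((\<lambda>t. G \<tau> t) \<longlongrightarrow> l \<tau>) F) \<Longrightarrow> ((\<lambda>t. \<Sum>\<tau>\<leftarrow>xs. G \<tau> t) \<longlongrightarrow> (\<Sum>\<tau>\<leftarrow>xs. l \<tau>)) F"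
  by (induction xs) (auto intro!: tendsto_add)

lemma sum_list_difference_quotient:
  fixes G :: "'a \<Rightarrow> 'k::field"
  shows "((\<Sum>\<tau>\<leftarrow>xs. G \<tau>) - (\<Sum>\<tau>\<leftarrow>xs. H \<tau>)) / t = (\<Sum>\<tau>\<leftarrow>xs. (G \<tau> - H \<tau>) / t)"
  by (induction xs) (simp_all add: diff_divide_distrib add_divide_distrib)

lemma jet_cong:
  assumes "\<And>i. i \<in> set I \<Longrightarrow> ys i = zs i"
  shows "jet sc f I (x, ys) = jet sc f I (x, zs)"
  unfolding jet_def fst_conv snd_conv
  by (rule ext, rule iter_dd_cong) (use assms in \<open>auto split: nat.split\<close>)

lemma limitin_filterlim_compose:
  "limitin X f l F \<Longrightarrow> filterlim s F G \<Longrightarrow> limitin X (\<lambda>n. f (s n)) l G"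
  unfolding limitin_def filterlim_iff by blast

context open_in_poisson_space
begin

definition leibniz_term :: "('e \<Rightarrow> 'k) \<Rightarrow> ('e \<Rightarrow> 'k) \<Rightarrow> leibniz_index \<Rightarrow> 'e \<times> (nat \<Rightarrow> 'e) \<Rightarrow> 'k" where
  "leibniz_term f g = (\<lambda>(I, J, c) p.
     br (jet sc f I p) (jet sc g J p) (case c of None \<Rightarrow> fst p | Some i \<Rightarrow> snd p i))"

text \<open>Testing the limit on sequences keeps the jets \<open>b n\<close>, the quotients
  \<open>Db n\<close> and the evaluation points eventually in compact sets, as hypocontinuity
  requires. The quotient telescopes: the first jet changes while the second is taken at
  \<open>X n\<close>, then the second changes while the first is taken at \<open>x\<close>, and
  finally the evaluation point changes.\<close>

lemma leibniz_term_derivative: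
  assumes f: "smooth_on sc T U f" and g: "smooth_on sc T U g" and x: "x \<in> U"
    and I: "set I \<subseteq> {..<k}" and J: "set J \<subseteq> {..<k}"
  shows "((\<lambda>t. (leibniz_term f g (I, J, c) (x + sc t (ys k), ys) - leibniz_term f g (I, J, c) (x, ys)) / t)
    \<longlongrightarrow> (\<Sum>\<sigma>\<leftarrow>leibniz_step k (I, J, c). leibniz_term f g \<sigma> (x, ys))) (at 0)"
  unfolding tendsto_at_iff_sequentially
proof (intro allI impI)
  fix s :: "nat \<Rightarrow> 'k"
  assume s_ne: "\<forall>i. s i \<in> UNIV - {0}" and s0: "s \<longlonglongrightarrow> 0"
  have s: "filterlim s (at 0) sequentially"
    using s_ne s0 by (auto simp: filterlim_at)
  let ?w = "ys k"
  define X where "X n = x + sc (s n) ?w" for n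
  define a b where "a n = jet sc f I (X n, ys)" and "b n = jet sc g J (X n, ys)" for n
  define a0 b0 where "a0 = jet sc f I (x, ys)" and "b0 = jet sc g J (x, ys)"
  define Da Db where "Da n = (\<lambda>z. (a n z - a0 z) / s n)" and "Db n = (\<lambda>z. (b n z - b0 z) / s n)" for n
  define u where "u y = (case c of None \<Rightarrow> y | Some i \<Rightarrow> ys i)" for y
  \<comment> \<open>The share of the evaluation point in the quotient: \<open>br a0 b0\<close> is
    linear and \<open>u (X n) - u x\<close> is either \<open>sc (s n) (ys k)\<close> or 0, so this
    share does not depend on \<open>n\<close>.\<close>
  define r where "r = (case c of None \<Rightarrow> br a0 b0 ?w | Some i \<Rightarrow> 0)"
  have X: "limitin T X x sequentially"
    unfolding X_def by (rule limitin_filterlim_compose[OF limitin_line s])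
  have a0: "a0 \<in> E'" and b0: "b0 \<in> E'"
    unfolding a0_def b0_def using x by (auto intro: jet_in_dual f g)
  have Da: "limitin E'\<^sub>c Da (jet sc f (I @ [k]) (x, ys)) sequentially"
    unfolding Da_def a_def a0_def X_def
    by (rule limitin_filterlim_compose[OF limitin_jet_difference_quotient[OF f x] s])
  have Db: "limitin E'\<^sub>c Db (jet sc g (J @ [k]) (x, ys)) sequentially"
    unfolding Db_def b_def b0_def X_def
    by (rule limitin_filterlim_compose[OF limitin_jet_difference_quotient[OF g x] s])
  have b: "limitin E'\<^sub>c b b0 sequentially"
  proof -
    have "limitin (dk_domain T U k) (\<lambda>n. (X n, restrict ys {..<k})) (x, restrict ys {..<k}) sequentially"
      by (rule limitin_dk_domain[OF X x]) simp
    moreover have "jet sc g J (y, restrict ys {..<k}) = jet sc g J (y, ys)" for y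
      by (rule jet_cong) (use J in auto)
    ultimately show ?thesis
      unfolding b_def b0_def using limitin_jet[OF g _ J] by fastforce
  qed
  have "limitin E'\<^sub>c (\<lambda>n. br (Da n) (b n)) (br (jet sc f (I @ [k]) (x, ys)) b0) sequentially"
    using limitin_compact_tail[OF b] by (intro limitin_br[OF Da b]) blast
  moreover have "limitin E'\<^sub>c (\<lambda>n. br a0 (Db n)) (br a0 (jet sc g (J @ [k]) (x, ys))) sequentially"
    using limitin_compact_tail[OF Db] a0 by (intro limitin_br[OF _ Db]) auto
  moreover have u: "limitin T (\<lambda>n. u (X n)) (u x) sequentially"
    unfolding u_def using X by (auto split: option.split)
  moreover obtain C where "compactin T C" "\<forall>\<^sub>F n in sequentially. u (X n) \<in> C"
    using limitin_compact_tail[OF u] by blast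
  ultimately have lim: "(\<lambda>n. br (Da n) (b n) (u (X n)) + br a0 (Db n) (u (X n)) + r)
      \<longlonglongrightarrow> br (jet sc f (I @ [k]) (x, ys)) b0 (u x) + br a0 (jet sc g (J @ [k]) (x, ys)) (u x) + r"
    by (intro tendsto_add tendsto_const tendsto_dual_eval)
  have "\<forall>\<^sub>F n in sequentially. br (Da n) (b n) (u (X n)) + br a0 (Db n) (u (X n)) + r =
     (leibniz_term f g (I, J, c) (x + sc (s n) ?w, ys) - leibniz_term f g (I, J, c) (x, ys)) / s n"
    using eventually_in_U[OF X x]
  proof (rule eventually_mono)
    fix n assume "X n \<in> U"
    then have an: "a n \<in> E'" and bn: "b n \<in> E'"
      unfolding a_def b_def by (auto intro: jet_in_dual f g)
    have "br a0 b0 (y + z) = br a0 b0 y + br a0 b0 z" "br a0 b0 (sc q z) = q * br a0 b0 z" for y z q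
      using br_in_dual[OF a0 b0] by (simp_all add: dual_def)
    then have r: "r = (br a0 b0 (u (X n)) - br a0 b0 (u x)) / s n"
      using s_ne by (simp add: u_def r_def X_def split: option.split)
    have "br (Da n) (b n) (u (X n)) + br a0 (Db n) (u (X n)) + r =
        (br (a n) (b n) (u (X n)) - br a0 b0 (u x)) / s n"
      unfolding Da_def Db_def br_diff_divide_left[OF an a0 bn] br_diff_divide_right[OF bn b0 a0] r
      by (simp add: diff_divide_distrib)
    then show "br (Da n) (b n) (u (X n)) + br a0 (Db n) (u (X n)) + r =
      (leibniz_term f g (I, J, c) (x + sc (s n) ?w, ys) - leibniz_term f g (I, J, c) (x, ys)) / s n"
      by (simp add: leibniz_term_def a_def b_def a0_def b0_def u_def X_def cong: option.case_cong)
  qed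
  then have "(\<lambda>n. (leibniz_term f g (I, J, c) (x + sc (s n) ?w, ys) - leibniz_term f g (I, J, c) (x, ys)) / s n)
      \<longlonglongrightarrow> br (jet sc f (I @ [k]) (x, ys)) b0 (u x) + br a0 (jet sc g (J @ [k]) (x, ys)) (u x) + r"
    using lim by (rule Lim_transform_eventually[rotated])
  moreover have "(\<Sum>\<sigma>\<leftarrow>leibniz_step k (I, J, c). leibniz_term f g \<sigma> (x, ys)) =
      br (jet sc f (I @ [k]) (x, ys)) b0 (u x) + br a0 (jet sc g (J @ [k]) (x, ys)) (u x) + r"
    by (cases c) (simp_all add: leibniz_term_def u_def r_def a0_def b0_def)
  ultimately show "((\<lambda>t. (leibniz_term f g (I, J, c) (x + sc t ?w, ys) - leibniz_term f g (I, J, c) (x, ys)) / t) \<circ> s)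
      \<longlonglongrightarrow> (\<Sum>\<sigma>\<leftarrow>leibniz_step k (I, J, c). leibniz_term f g \<sigma> (x, ys))"
    by (simp add: o_def)
qed

abbreviation "pb \<equiv> poisson_bracket sc br U"

lemma leibniz_sum_derivative:
  assumes "smooth_on sc T U f" "smooth_on sc T U g" "x \<in> U"
  shows "((\<lambda>t. ((\<Sum>\<tau>\<leftarrow>leibniz_indices k. leibniz_term f g \<tau> (x + sc t (ys k), ys))
      - (\<Sum>\<tau>\<leftarrow>leibniz_indices k. leibniz_term f g \<tau> (x, ys))) / t)
    \<longlongrightarrow> (\<Sum>\<tau>\<leftarrow>leibniz_indices (Suc k). leibniz_term f g \<tau> (x, ys))) (at 0)"
  unfolding sum_list_difference_quotient leibniz_indices.simps sum_list_concat_map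
proof (rule tendsto_sum_list)
  fix \<tau> assume \<tau>: "\<tau> \<in> set (leibniz_indices k)"
  obtain I J c where "\<tau> = (I, J, c)" by (cases \<tau>) blast
  with \<tau> show "((\<lambda>t. (leibniz_term f g \<tau> (x + sc t (ys k), ys) - leibniz_term f g \<tau> (x, ys)) / t)
      \<longlongrightarrow> (\<Sum>\<sigma>\<leftarrow>leibniz_step k \<tau>. leibniz_term f g \<sigma> (x, ys))) (at 0)"
    using leibniz_term_derivative[OF assms] leibniz_indices_bounded by blast
qed

text \<open>As \<open>iter_dd\<close> is a \<open>Lim\<close>, the formula at order
  \<open>k + 1\<close> is read off from the convergence at order \<open>k\<close>, so both are
  proved in one induction. The formula must be known at all points of \<open>U\<close>, since
  difference quotients use points near \<open>x\<close>.\<close>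

lemma poisson_bracket_derivative:
  assumes f: "smooth_on sc T U f" and g: "smooth_on sc T U g" and x: "x \<in> U"
  shows "iter_dd sc (pb f g) k x ys = (\<Sum>\<tau>\<leftarrow>leibniz_indices k. leibniz_term f g \<tau> (x, ys)) \<and>
    ((\<lambda>t. (iter_dd sc (pb f g) k (x + sc t (ys k)) ys - iter_dd sc (pb f g) k x ys) / t)
      \<longlongrightarrow> (\<Sum>\<tau>\<leftarrow>leibniz_indices (Suc k). leibniz_term f g \<tau> (x, ys))) (at 0)"
  using x
proof (induction k arbitrary: x)
  have lift: "((\<lambda>t. (iter_dd sc (pb f g) k (x + sc t (ys k)) ys - iter_dd sc (pb f g) k x ys) / t)
      \<longlongrightarrow> (\<Sum>\<tau>\<leftarrow>leibniz_indices (Suc k). leibniz_term f g \<tau> (x, ys))) (at 0)"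
    if eq: "\<And>x. x \<in> U \<Longrightarrow> iter_dd sc (pb f g) k x ys = (\<Sum>\<tau>\<leftarrow>leibniz_indices k. leibniz_term f g \<tau> (x, ys))"
      and x: "x \<in> U" for k x
  proof (rule Lim_transform_eventually[OF leibniz_sum_derivative[OF f g x]])
    show "\<forall>\<^sub>F t in at 0. ((\<Sum>\<tau>\<leftarrow>leibniz_indices k. leibniz_term f g \<tau> (x + sc t (ys k), ys))
        - (\<Sum>\<tau>\<leftarrow>leibniz_indices k. leibniz_term f g \<tau> (x, ys))) / t =
        (iter_dd sc (pb f g) k (x + sc t (ys k)) ys - iter_dd sc (pb f g) k x ys) / t"
      using eventually_line_in_U[OF x, of "ys k"] by (rule eventually_mono) (simp add: eq x)
  qed
  {
    case 0
    have "iter_dd sc (pb f g) 0 x ys = (\<Sum>\<tau>\<leftarrow>leibniz_indices 0. leibniz_term f g \<tau> (x, ys))"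
      if "x \<in> U" for x
      using that by (simp add: iter_dd.simps(1) poisson_bracket_def leibniz_term_def fderiv1_eq_jet[of _ _ _ ys])
    then show ?case using lift 0 by blast
  next
    case (Suc k)
    have "iter_dd sc (pb f g) (Suc k) x ys = (\<Sum>\<tau>\<leftarrow>leibniz_indices (Suc k). leibniz_term f g \<tau> (x, ys))"
      if "x \<in> U" for x
      using Suc.IH[OF that] by (simp only: iter_dd.simps(2)) (auto intro: tendsto_Lim)
    then show ?case using lift Suc.prems by blast
  }
qed

text \<open>The compact set \<open>K\<close> serves three times: for the convergence of jets of
  varying functions, for compact sets of jets when a function stays in \<open>M\<close>, and,
  through its image under the choice of evaluation point, for the final evaluation.\<close>

lemma tendsto_poisson_bracket:
  assumes f: "limitin (Cinf_topology sc T U) f f0 F" and g: "limitin (Cinf_topology sc T U) g g0 F"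
    and p: "limitin (dk_domain T U k) p q F" and K: "compactin (dk_domain T U k) K" "\<forall>\<^sub>F i in F. p i \<in> K"
    and M: "(\<exists>M. compactin (Cinf_topology sc T U) M \<and> (\<forall>\<^sub>F i in F. g i \<in> M)) \<or>
      (\<exists>M. compactin (Cinf_topology sc T U) M \<and> (\<forall>\<^sub>F i in F. f i \<in> M)) \<or>
      continuous_map (prod_topology E'\<^sub>c E'\<^sub>c) E'\<^sub>c (\<lambda>(a, b). br a b)"
  shows "((\<lambda>i. iter_dd sc (pb (f i) (g i)) k (fst (p i)) (snd (p i)))
    \<longlongrightarrow> iter_dd sc (pb f0 g0) k (fst q) (snd q)) F"
proof -
  have fst_lim: "limitin T (\<lambda>i. fst (p i)) (fst q) F" by (rule limitin_dk_domain_fst[OF p])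
  have q: "fst q \<in> U" using limitin_topspace[OF p] topspace_dk_domain by auto
  have f0: "smooth_on sc T U f0" and g0: "smooth_on sc T U g0"
    and ev: "\<forall>\<^sub>F i in F. smooth_on sc T U (f i) \<and> smooth_on sc T U (g i)"
    using f g Cinf_smooth_on unfolding limitin_Cinf_topology
    by (auto intro!: eventually_conj elim: eventually_mono)
  have jets: "\<exists>N. compactin E'\<^sub>c N \<and> (\<forall>\<^sub>F i in F. jet sc (h i) I (p i) \<in> N)"
    if M': "compactin (Cinf_topology sc T U) M" and h: "\<forall>\<^sub>F i in F. h i \<in> M" and I: "set I \<subseteq> {..<k}" for M h I
  proof -
    obtain N where N: "compactin E'\<^sub>c N" "\<forall>g\<in>M. \<forall>p\<in>K. jet sc g I p \<in> N"
      using compactin_jets[OF M' K(1) I] by blast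
    have "\<forall>\<^sub>F i in F. jet sc (h i) I (p i) \<in> N"
      using h K(2) by eventually_elim (use N in blast)
    then show ?thesis using N by blast
  qed
  have "((\<lambda>i. leibniz_term (f i) (g i) \<tau> (p i)) \<longlongrightarrow> leibniz_term f0 g0 \<tau> q) F"
    if \<tau>: "\<tau> \<in> set (leibniz_indices k)" for \<tau>
  proof -
    obtain I J c where \<tau>_eq: "\<tau> = (I, J, c)" by (cases \<tau>) blast
    have I: "set I \<subseteq> {..<k}" and J: "set J \<subseteq> {..<k}" and c: "\<And>i. c = Some i \<Longrightarrow> i < k"
      using leibniz_indices_bounded \<tau> \<tau>_eq by auto
    define u :: "'e \<times> (nat \<Rightarrow> 'e) \<Rightarrow> 'e" where "u p = (case c of None \<Rightarrow> fst p | Some i \<Rightarrow> snd p i)" for p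
    have u_cont: "continuous_map (dk_domain T U k) T u"
      unfolding continuous_map_iff_limitin
      unfolding u_def
      using limitin_dk_domain_fst[OF limitin_id_nhdsin] limitin_dk_domain_snd[OF limitin_id_nhdsin c]
      by (auto split: option.split)
    have "limitin E'\<^sub>c (\<lambda>i. br (jet sc (f i) I (p i)) (jet sc (g i) J (p i))) (br (jet sc f0 I q) (jet sc g0 J q)) F"
      using M jets I J by (intro limitin_br limitin_jet_Cinf[OF f p K I] limitin_jet_Cinf[OF g p K J]) blast
    then have "((\<lambda>i. br (jet sc (f i) I (p i)) (jet sc (g i) J (p i)) (u (p i)))
        \<longlongrightarrow> br (jet sc f0 I q) (jet sc g0 J q) (u q)) F"
    proof (rule tendsto_dual_eval)
      show "limitin T (\<lambda>i. u (p i)) (u q) F" by (rule continuous_map_limitin[OF u_cont p])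
      show "compactin T (u ` K)" by (rule image_compactin[OF K(1) u_cont])
      show "\<forall>\<^sub>F i in F. u (p i) \<in> u ` K" using K(2) by (rule eventually_mono) simp
    qed
    then show ?thesis by (simp add: leibniz_term_def \<tau>_eq u_def)
  qed
  then have "((\<lambda>i. \<Sum>\<tau>\<leftarrow>leibniz_indices k. leibniz_term (f i) (g i) \<tau> (p i))
      \<longlongrightarrow> (\<Sum>\<tau>\<leftarrow>leibniz_indices k. leibniz_term f0 g0 \<tau> q)) F"
    by (rule tendsto_sum_list)
  moreover have "(\<Sum>\<tau>\<leftarrow>leibniz_indices k. leibniz_term f0 g0 \<tau> q) = iter_dd sc (pb f0 g0) k (fst q) (snd q)"
    using poisson_bracket_derivative[OF f0 g0 q, of k "snd q"] by simp
  moreover have "\<forall>\<^sub>F i in F. (\<Sum>\<tau>\<leftarrow>leibniz_indices k. leibniz_term (f i) (g i) \<tau> (p i)) =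
      iter_dd sc (pb (f i) (g i)) k (fst (p i)) (snd (p i))"
    using ev eventually_in_U[OF fst_lim q]
    by eventually_elim (use poisson_bracket_derivative in force)
  ultimately show ?thesis using Lim_transform_eventually by fastforce
qed

end

section \<open>Hypocontinuity of the Poisson bracket\<close>

context open_in_lcs
begin

text \<open>\<open>U \<times> E^k\<close> is homeomorphic to the open set \<open>S\<close> of tuples
  in \<open>E^(k+1)\<close> whose entry \<open>k\<close> lies in \<open>U\<close>, and open
  subspaces of Hausdorff k-spaces are k-spaces. Storing the base point last leaves the indices of
  the directions unchanged.\<close>

lemma k_space_dk_domain:
  assumes T: "k_infty_space T"
  shows "k_space (dk_domain T U k)"
proof -
  let ?P = "product_topology (\<lambda>_. T) {..<Suc k}"
  define S where "S = {y \<in> topspace ?P. y k \<in> U}"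
  let ?S = "subtopology ?P S"
  have proj: "continuous_map ?P T (\<lambda>y. y i)" if "i < Suc k" for i
    using continuous_map_product_projection[of i "{..<Suc k}" "\<lambda>_. T"] that by simp
  have "openin ?P S"
    unfolding S_def using openin_continuous_map_preimage[OF proj[of k] open_U] by simp
  moreover have "Hausdorff_space ?P"
    using T unfolding k_infty_space_def by (simp add: Hausdorff_space_product_topology)
  ultimately have "k_space ?S"
    using T unfolding k_infty_space_def by (intro k_space_open_subtopology) auto
  moreover have "homeomorphic_maps ?S (dk_domain T U k)
      (\<lambda>y. (y k, restrict y {..<k})) (\<lambda>p. restrict ((snd p)(k := fst p)) {..<Suc k})"
    unfolding homeomorphic_maps_def
  proof (intro conjI)
    show "continuous_map ?S (dk_domain T U k) (\<lambda>y. (y k, restrict y {..<k}))"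
      unfolding continuous_map_iff_limitin
    proof
      fix y assume y: "y \<in> topspace ?S"
      have "limitin T (\<lambda>y. y i) (y i) (nhdsin ?S y)" if "i < Suc k" for i
        using continuous_map_from_subtopology[OF proj[OF that], of S] y
        unfolding continuous_map_iff_limitin by blast
      then show "limitin (dk_domain T U k) (\<lambda>y. (y k, restrict y {..<k})) (y k, restrict y {..<k}) (nhdsin ?S y)"
        using y by (intro limitin_dk_domain) (auto simp: S_def)
    qed
    show "continuous_map (dk_domain T U k) ?S (\<lambda>p. restrict ((snd p)(k := fst p)) {..<Suc k})"
      unfolding continuous_map_in_subtopology
    proof
      show "continuous_map (dk_domain T U k) ?P (\<lambda>p. restrict ((snd p)(k := fst p)) {..<Suc k})"
        unfolding continuous_map_iff_limitin
      proof
        fix p assume p: "p \<in> topspace (dk_domain T U k)"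
        note id = limitin_id_nhdsin[OF p]
        show "limitin ?P (\<lambda>p. restrict ((snd p)(k := fst p)) {..<Suc k})
            (restrict ((snd p)(k := fst p)) {..<Suc k}) (nhdsin (dk_domain T U k) p)"
          using limitin_dk_domain_fst[OF id] limitin_dk_domain_snd[OF id]
          by (auto simp: limitin_componentwise)
      qed
      show "(\<lambda>p. restrict ((snd p)(k := fst p)) {..<Suc k}) \<in> topspace (dk_domain T U k) \<rightarrow> S"
        by (auto simp: S_def topspace_dk_domain split: if_splits)
    qed
    show "\<forall>y\<in>topspace ?S. restrict ((snd (y k, restrict y {..<k}))(k := fst (y k, restrict y {..<k}))) {..<Suc k} = y"
    proof
      fix y assume y: "y \<in> topspace ?S"
      then have "y \<in> extensional {..<Suc k}" by (auto simp: PiE_def)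
      then show "restrict ((snd (y k, restrict y {..<k}))(k := fst (y k, restrict y {..<k}))) {..<Suc k} = y"
        by (auto simp: fun_eq_iff extensional_def less_Suc_eq restrict_def)
    qed
    show "\<forall>p\<in>topspace (dk_domain T U k). ((restrict ((snd p)(k := fst p)) {..<Suc k}) k,
        restrict (restrict ((snd p)(k := fst p)) {..<Suc k}) {..<k}) = p"
      by (auto simp: topspace_dk_domain extensional_def fun_eq_iff restrict_def)
  qed
  then have "?S homeomorphic_space dk_domain T U k"
    unfolding homeomorphic_space_def by blast
  ultimately show ?thesis using homeomorphic_k_space by blast
qed

text \<open>Members of \<open>Cinf sc T U\<close> are extensional, so the zero vector is
  \<open>restrict (\<lambda>_. 0) U\<close>, whose value off \<open>U\<close> is unspecified. Its
  derivatives vanish because difference quotients at a point of \<open>U\<close> see only points of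
  \<open>U\<close> for small \<open>t\<close>.\<close>

lemma iter_dd_zero: "x \<in> U \<Longrightarrow> iter_dd sc (restrict (\<lambda>_. 0) U) k x ys = 0"
proof (induction k arbitrary: x)
  case (Suc k)
  let ?d = "iter_dd sc (restrict (\<lambda>_. 0) U) k"
  have "\<forall>\<^sub>F t in at 0. (?d (x + sc t (ys k)) ys - ?d x ys) / t = 0"
    using eventually_line_in_U[OF Suc.prems, of "ys k"] by (rule eventually_mono) (simp add: Suc)
  then have "((\<lambda>t. (?d (x + sc t (ys k)) ys - ?d x ys) / t) \<longlongrightarrow> 0) (at 0)"
    by (rule tendsto_eventually)
  then show ?case by (simp only: iter_dd.simps(2)) (auto intro: tendsto_Lim)
qed (simp add: iter_dd.simps)

lemma zero_in_Cinf: "restrict (\<lambda>_. 0) U \<in> Cinf sc T U"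
proof -
  let ?z = "restrict (\<lambda>_. 0) U"
  have "((\<lambda>t. (iter_dd sc ?z k (x + sc t (ys k)) ys - iter_dd sc ?z k x ys) / t)
      \<longlongrightarrow> iter_dd sc ?z (Suc k) x ys) (at 0)" if x: "x \<in> U" for k x ys
  proof -
    have "\<forall>\<^sub>F t in at 0. (iter_dd sc ?z k (x + sc t (ys k)) ys - iter_dd sc ?z k x ys) / t
        = iter_dd sc ?z (Suc k) x ys"
      using eventually_line_in_U[OF x, of "ys k"] by (rule eventually_mono) (simp add: iter_dd_zero x)
    then show ?thesis by (rule tendsto_eventually)
  qed
  moreover have "continuous_map (dk_domain T U k) euclidean (\<lambda>(x, ys). iter_dd sc ?z k x ys)" for k
    by (rule continuous_map_eq[of _ _ "\<lambda>_. 0"]) (auto simp: topspace_dk_domain iter_dd_zero)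
  ultimately show ?thesis unfolding Cinf_def smooth_on_def by auto
qed

end

section \<open>Smoothness, hypocontinuity and continuity of the bracket of functions\<close>

context open_in_poisson_space
begin

abbreviation "CU \<equiv> Cinf sc T U"
abbreviation "CU_top \<equiv> Cinf_topology sc T U"

lemma poisson_bracket_in_Cinf:
  assumes f: "f \<in> CU" and g: "g \<in> CU"
  shows "pb f g \<in> CU"
proof -
  note fg = Cinf_smooth_on[OF f] Cinf_smooth_on[OF g]
  have "((\<lambda>t. (iter_dd sc (pb f g) k (x + sc t (ys k)) ys - iter_dd sc (pb f g) k x ys) / t)
      \<longlongrightarrow> iter_dd sc (pb f g) (Suc k) x ys) (at 0)" if x: "x \<in> U" for k x ys
    unfolding poisson_bracket_derivative[OF fg x, of "Suc k" ys, THEN conjunct1]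
    by (rule poisson_bracket_derivative[OF fg x, THEN conjunct2])
  moreover have "continuous_map (dk_domain T U k) euclidean (\<lambda>p. iter_dd sc (pb f g) k (fst p) (snd p))" for k
  proof (rule continuous_map_from_k_space)
    show "k_space (dk_domain T U k)"
      by (rule k_space_dk_domain[OF poisson[unfolded lc_poisson_space_def, THEN conjunct2, THEN conjunct1]])
    fix K assume K: "compactin (dk_domain T U k) K"
    show "continuous_map (subtopology (dk_domain T U k) K) euclidean (\<lambda>p. iter_dd sc (pb f g) k (fst p) (snd p))"
      unfolding continuous_map_iff_limitin
    proof
      fix p assume "p \<in> topspace (subtopology (dk_domain T U k) K)"
      then have p: "limitin (dk_domain T U k) (\<lambda>a. a) p (nhdsin (subtopology (dk_domain T U k) K) p)"
        by (intro limitin_id_nhdsin_subtopology) (use compactin_subset_topspace[OF K] in auto)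
      have "((\<lambda>p. iter_dd sc (pb f g) k (fst p) (snd p)) \<longlongrightarrow> iter_dd sc (pb f g) k (fst p) (snd p))
          (nhdsin (subtopology (dk_domain T U k) K) p)"
        by (rule tendsto_poisson_bracket[OF _ _ p K eventually_nhdsin_subtopology])
          (use f g in \<open>auto intro!: disjI1 exI[of _ "{g}"]\<close>)
      then show "limitin euclidean (\<lambda>p. iter_dd sc (pb f g) k (fst p) (snd p))
          (iter_dd sc (pb f g) k (fst p) (snd p)) (nhdsin (subtopology (dk_domain T U k) K) p)"
        by simp
    qed
  qed
  moreover have "pb f g \<in> extensional U" by (simp add: poisson_bracket_def)
  ultimately show ?thesis
    unfolding Cinf_def smooth_on_def by (auto simp: case_prod_unfold)
qed

text \<open>Uniform convergence on \<open>K\<close> follows by the tube lemma from convergence along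
  pairs of an index and a point of \<open>K\<close>, where the point is confined to \<open>K\<close>
  by construction. Comparing with \<open>pb f0 g0\<close> at the moving point uses the continuity of
  its derivatives, hence its smoothness.\<close>

lemma limitin_poisson_bracket:
  assumes f: "limitin CU_top f f0 F" and g: "limitin CU_top g g0 F"
    and M: "(\<exists>M. compactin CU_top M \<and> (\<forall>\<^sub>F i in F. g i \<in> M)) \<or>
      (\<exists>M. compactin CU_top M \<and> (\<forall>\<^sub>F i in F. f i \<in> M)) \<or>
      continuous_map (prod_topology E'\<^sub>c E'\<^sub>c) E'\<^sub>c (\<lambda>(a, b). br a b)"
  shows "limitin CU_top (\<lambda>i. pb (f i) (g i)) (pb f0 g0) F"
  unfolding limitin_Cinf_topology
proof (intro conjI allI impI)
  have f0: "f0 \<in> CU" and g0: "g0 \<in> CU" and ev: "\<forall>\<^sub>F i in F. f i \<in> CU \<and> g i \<in> CU"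
    using f g unfolding limitin_Cinf_topology by (auto intro: eventually_conj)
  show pb0: "pb f0 g0 \<in> CU" by (rule poisson_bracket_in_Cinf[OF f0 g0])
  show "\<forall>\<^sub>F i in F. pb (f i) (g i) \<in> CU"
    using ev by (rule eventually_mono) (blast intro: poisson_bracket_in_Cinf)
  fix k K and e :: real
  assume K: "compactin (dk_domain T U k) K" and e: "e > 0"
  show "\<forall>\<^sub>F i in F. \<forall>p\<in>K. norm (iter_dd sc (pb (f i) (g i)) k (fst p) (snd p)
      - iter_dd sc (pb f0 g0) k (fst p) (snd p)) < e"
  proof (rule eventually_compactin[OF K])
    fix p assume p: "p \<in> K"
    let ?F = "F \<times>\<^sub>F nhdsin (subtopology (dk_domain T U k) K) p"
    have lim: "limitin (dk_domain T U k) (\<lambda>a. snd a) p ?F"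
      by (rule limitin_prod_filter2[OF limitin_id_nhdsin_subtopology[OF compactin_subset_topspace[OF K] p]])
    have lift: "\<forall>\<^sub>F a in ?F. h (fst a) \<in> M" if "\<forall>\<^sub>F i in F. h i \<in> M" for h M
      by (rule eventually_prod_filter1[OF that])
    have "((\<lambda>a. iter_dd sc (pb (f (fst a)) (g (fst a))) k (fst (snd a)) (snd (snd a)))
        \<longlongrightarrow> iter_dd sc (pb f0 g0) k (fst p) (snd p)) ?F"
    proof (rule tendsto_poisson_bracket[OF _ _ lim K])
      show "limitin CU_top (\<lambda>a. f (fst a)) f0 ?F" "limitin CU_top (\<lambda>a. g (fst a)) g0 ?F"
        by (rule limitin_prod_filter1[OF f], rule limitin_prod_filter1[OF g])
      show "\<forall>\<^sub>F a in ?F. snd a \<in> K"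
        by (rule eventually_prod_filter2[OF eventually_nhdsin_subtopology])
      show "(\<exists>M. compactin CU_top M \<and> (\<forall>\<^sub>F a in ?F. g (fst a) \<in> M)) \<or>
          (\<exists>M. compactin CU_top M \<and> (\<forall>\<^sub>F a in ?F. f (fst a) \<in> M)) \<or>
          continuous_map (prod_topology E'\<^sub>c E'\<^sub>c) E'\<^sub>c (\<lambda>(a, b). br a b)"
        using M lift by blast
    qed
    moreover have "((\<lambda>a. iter_dd sc (pb f0 g0) k (fst (snd a)) (snd (snd a)))
        \<longlongrightarrow> iter_dd sc (pb f0 g0) k (fst p) (snd p)) ?F"
      using continuous_map_limitin[OF continuous_map_iter_dd[OF pb0] lim] by simp
    ultimately have "((\<lambda>a. iter_dd sc (pb (f (fst a)) (g (fst a))) k (fst (snd a)) (snd (snd a))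
        - iter_dd sc (pb f0 g0) k (fst (snd a)) (snd (snd a)))
        \<longlongrightarrow> iter_dd sc (pb f0 g0) k (fst p) (snd p) - iter_dd sc (pb f0 g0) k (fst p) (snd p)) ?F"
      by (rule tendsto_diff)
    from tendstoD[OF this e]
    show "\<forall>\<^sub>F a in ?F. norm (iter_dd sc (pb (f (fst a)) (g (fst a))) k (fst (snd a)) (snd (snd a))
        - iter_dd sc (pb f0 g0) k (fst (snd a)) (snd (snd a))) < e"
      by simp
  qed
qed

lemma poisson_bracket_zero_left:
  assumes g: "g \<in> CU"
  shows "pb (restrict (\<lambda>_. 0) U) g = restrict (\<lambda>_. 0) U"
proof
  fix x
  show "pb (restrict (\<lambda>_. 0) U) g x = restrict (\<lambda>_. 0) U x"
  proof (cases "x \<in> U")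
    case True
    have "fderiv1 sc g x \<in> E'"
      unfolding fderiv1_eq_jet[where ys = undefined]
      using jet_in_dual[OF Cinf_smooth_on[OF g]] True by simp
    from br_scale_left[OF zero_in_dual this, of 0]
    have "br (\<lambda>_. 0) (fderiv1 sc g x) = (\<lambda>_. 0)" by simp
    moreover have "fderiv1 sc (restrict (\<lambda>_. 0) U) x = (\<lambda>_. 0)"
      by (simp add: fderiv1_def iter_dd_zero True)
    ultimately show ?thesis using True by (simp add: poisson_bracket_def)
  qed (simp add: poisson_bracket_def)
qed

text \<open>For each \<open>m\<close> in \<open>M\<close> the brackets tend to the zero function as
  the first argument tends to zero and the second tends to \<open>m\<close> within \<open>M\<close>;
  the tube lemma over \<open>M\<close> merges the resulting neighbourhoods into a single
  \<open>V\<close>. For separate continuity, the singleton of the fixed function is the compact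
  set.\<close>

lemma hypocontinuous_poisson_bracket:
  "hypocontinuous2 CU_top CU_top CU_top pb (restrict (\<lambda>_. 0) U) (restrict (\<lambda>_. 0) U)"
  unfolding hypocontinuous2_def
proof (intro conjI ballI allI impI)
  fix g assume g: "g \<in> topspace CU_top"
  then have const: "limitin CU_top (\<lambda>_. g) g F" "\<exists>M. compactin CU_top M \<and> (\<forall>\<^sub>F i in F. g \<in> M)"
    for F :: "('e \<Rightarrow> 'k) filter"
    by simp (rule exI[of _ "{g}"], use g in simp)
  show "continuous_map CU_top CU_top (\<lambda>f. pb f g)"
    unfolding continuous_map_iff_limitin
    using limitin_poisson_bracket[OF limitin_id_nhdsin const(1) disjI1[OF const(2)]] by blast
  show "continuous_map CU_top CU_top (\<lambda>f. pb g f)"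
    unfolding continuous_map_iff_limitin
    using limitin_poisson_bracket[OF const(1) limitin_id_nhdsin disjI2[OF disjI1[OF const(2)]]] by blast
next
  let ?z = "restrict (\<lambda>_. 0) U :: 'e \<Rightarrow> 'k"
  fix M W assume "compactin CU_top M \<and> nbhd CU_top ?z W"
  then obtain G where M: "compactin CU_top M" and G: "openin CU_top G" "?z \<in> G" "G \<subseteq> W"
    unfolding nbhd_def by blast
  have "\<forall>\<^sub>F f in nhdsin CU_top ?z. \<forall>m\<in>M. pb f m \<in> G"
  proof (rule eventually_compactin[OF M])
    fix m assume m: "m \<in> M"
    let ?F = "nhdsin CU_top ?z \<times>\<^sub>F nhdsin (subtopology CU_top M) m"
    have m': "m \<in> CU" using compactin_subset_topspace[OF M] m by auto
    have "limitin CU_top (\<lambda>a. pb (fst a) (snd a)) (pb ?z m) ?F"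
    proof (rule limitin_poisson_bracket)
      show "limitin CU_top fst ?z ?F"
        by (rule limitin_prod_filter1[OF limitin_id_nhdsin]) (simp add: zero_in_Cinf)
      show "limitin CU_top snd m ?F"
        using limitin_prod_filter2[OF limitin_id_nhdsin_subtopology[OF compactin_subset_topspace[OF M] m]] .
      have M': "\<forall>\<^sub>F a in ?F. snd a \<in> M"
        by (rule eventually_prod_filter2[OF eventually_nhdsin_subtopology])
      show "(\<exists>M. compactin CU_top M \<and> (\<forall>\<^sub>F a in ?F. snd a \<in> M)) \<or>
          (\<exists>M. compactin CU_top M \<and> (\<forall>\<^sub>F a in ?F. fst a \<in> M)) \<or>
          continuous_map (prod_topology E'\<^sub>c E'\<^sub>c) E'\<^sub>c (\<lambda>(a, b). br a b)"
        by (intro disjI1 exI[of _ M] conjI M M')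
    qed
    then show "\<forall>\<^sub>F a in ?F. pb (fst a) (snd a) \<in> G"
      by (rule limitinD[OF _ G(1)]) (simp only: poisson_bracket_zero_left[OF m'] G(2))
  qed
  then obtain V where V: "openin CU_top V" "?z \<in> V" "\<forall>f\<in>V. \<forall>m\<in>M. pb f m \<in> G"
    unfolding eventually_nhdsin topspace_Cinf_topology using zero_in_Cinf by blast
  have "nbhd CU_top ?z V"
    unfolding nbhd_def using V(1,2) openin_subset[OF V(1)] by blast
  with V(3) G(3) show "\<exists>V. nbhd CU_top ?z V \<and> (\<forall>v\<in>V. \<forall>m\<in>M. pb v m \<in> W)"
    by blast
qed

lemma continuous_map_poisson_bracket:
  assumes br: "continuous_map (prod_topology E'\<^sub>c E'\<^sub>c) E'\<^sub>c (\<lambda>(a, b). br a b)"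
  shows "continuous_map (prod_topology CU_top CU_top) CU_top (\<lambda>(f, g). pb f g)"
  unfolding continuous_map_iff_limitin
proof
  let ?X = "prod_topology CU_top CU_top"
  fix r assume "r \<in> topspace ?X"
  from limitin_id_nhdsin[OF this]
  have "limitin CU_top fst (fst r) (nhdsin ?X r)" "limitin CU_top snd (snd r) (nhdsin ?X r)"
    by (simp_all add: limitin_pairwise o_def)
  from limitin_poisson_bracket[OF this] br
  show "limitin CU_top (\<lambda>(f, g). pb f g) ((\<lambda>(f, g). pb f g) r) (nhdsin ?X r)"
    by (simp add: case_prod_unfold)
qed

end

theorem theorem5p1:
  fixes sc :: "'k::real_normed_field \<Rightarrow> 'e::ab_group_add \<Rightarrow> 'e"
    and T :: "'e topology"
    and br :: "('e \<Rightarrow> 'k) \<Rightarrow> ('e \<Rightarrow> 'k) \<Rightarrow> ('e \<Rightarrow> 'k)"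
    and U :: "'e set"
  assumes "lc_poisson_space sc T br"
    and "openin T U"
  shows "(\<forall>f\<in>Cinf sc T U. \<forall>g\<in>Cinf sc T U. poisson_bracket sc br U f g \<in> Cinf sc T U)
    \<and> hypocontinuous2 (Cinf_topology sc T U) (Cinf_topology sc T U) (Cinf_topology sc T U)
         (poisson_bracket sc br U) (restrict (\<lambda>_. 0) U) (restrict (\<lambda>_. 0) U)
    \<and> (continuous_map (prod_topology (dual_c sc T) (dual_c sc T)) (dual_c sc T) (\<lambda>(a, b). br a b)
       \<longrightarrow> continuous_map (prod_topology (Cinf_topology sc T U) (Cinf_topology sc T U))
             (Cinf_topology sc T U) (\<lambda>(f, g). poisson_bracket sc br U f g))"
proof -
  interpret open_in_poisson_space sc T U br
  proof unfold_locales
    show "locally_convex_space sc T"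
      by (rule assms(1)[unfolded lc_poisson_space_def, THEN conjunct1])
  qed (rule assms)+
  show ?thesis
    by (intro conjI ballI impI poisson_bracket_in_Cinf hypocontinuous_poisson_bracket
        continuous_map_poisson_bracket)
qed

end
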